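(* Let $(P_n,\varphi_n^m)$ be a fine projective sequence of structures in $\mathcal F_0$, with projective limit $\mathbb P$, and let $p:\mathbb P\to\mathbb P/R^{\mathbb P}$ be the quotient map. Then $\mathbb P/R^{\mathbb P}$ is a smooth fence. Its connected components are exactly the maximal chains of the order $\le^{\mathbb P/R^{\mathbb P}}$; they are exactly the sets of the form $p[B]$ with $B$ a maximal chain of $(\mathbb P,\le^{\mathbb P})$; and if such a $B$ has more than two elements, then $p[B]$ is an arc.
   Context: Let $\mathcal L_R=\{R,\le\}$. A finite Hasse partial order is a finite (discrete) $\mathcal L_R$-structure in which $\le$ is a partial order and $a\,R\,b$ iff $a=b$ or one of $a,b$ is an immediate $\le$-successor of the other; it is a Hasse linear order (HLO) if $\le$ is total. $\mathcal F_0$ is the family of finite disjoint unions of finite HLOs (equivalently, finite Hasse forests with pairwise disjoint maximal chains). An epimorphism $\varphi:A\to B$ is a continuous surjection with $r^B=(\varphi\times\varphi)[r^A]$ for $r\in\{R,\le\}$. A projective sequence $(P_n,\varphi_n^m)_{n\le m}$ consists of structures $P_n$ and epimorphisms $\varphi_n^{n+1}:P_{n+1}\to P_n$, with $\varphi_n^m=\varphi_n^{n+1}\cdots\varphi_{m-1}^m$ and $\varphi_n^n$ the identity. Its projective limit is $\mathbb P=\{u\in\prod_nP_n:\forall n\ u(n)=\varphi_n^{n+1}(u(n+1))\}$ with the product topology and $r^{\mathbb P}(u,v)$ iff $r^{P_n}(u(n),v(n))$ for all $n$. The sequence is fine if $R^{\mathbb P}$ is an equivalence relation. On $\mathbb P/R^{\mathbb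 P}$ (quotient topology) the relation $\le^{\mathbb P/R^{\mathbb P}}$ is $(p\times p)[\le^{\mathbb P}]$, i.e. $x\le y$ iff there are $u\in p^{-1}(x),v\in p^{-1}(y)$ with $u\le^{\mathbb P}v$; for fine sequences in $\mathcal F_0$ this is a closed partial order. A fence is a compact metrizable space whose connected components are points or arcs; it is smooth if it carries a closed partial order whose restriction to each connected component is total. *)

theory Defs
  imports "HOL-Analysis.Analysis"
begin

record 'a lr_struct =
  univ :: "'a set"
  rel_R :: "('a \<times> 'a) set"
  rel_le :: "('a \<times> 'a) set"

text \<open>As usual in model theory, structures are non-empty. (For the empty structure the empty set
  would be a maximal chain, while the empty space has no connected component.)\<close>

definition lr_structure :: "'a lr_struct \<Rightarrow> bool" where
  "lr_structure A \<longleftrightarrow>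
     univ A \<noteq> {} \<and> rel_R A \<subseteq> univ A \<times> univ A \<and> rel_le A \<subseteq> univ A \<times> univ A"

definition immediate_successor :: "('a \<times> 'a) set \<Rightarrow> 'a \<Rightarrow> 'a \<Rightarrow> bool" where
  "immediate_successor r a b \<longleftrightarrow>
     (a, b) \<in> r \<and> a \<noteq> b \<and> (\<forall>c. (a, c) \<in> r \<and> (c, b) \<in> r \<longrightarrow> c = a \<or> c = b)"

definition finite_HPO :: "'a lr_struct \<Rightarrow> bool" where
  "finite_HPO A \<longleftrightarrow>
     lr_structure A \<and> finite (univ A) \<and> partial_order_on (univ A) (rel_le A) \<and>
     (\<forall>a\<in>univ A. \<forall>b\<in>univ A. (a, b) \<in> rel_R A \<longleftrightarrow>
        a = b \<or> immediate_successor (rel_le A) a b \<or> immediate_successor (rel_le A) b a)"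

definition finite_HLO :: "'a lr_struct \<Rightarrow> bool" where
  "finite_HLO A \<longleftrightarrow> finite_HPO A \<and> total_on (univ A) (rel_le A)"

definition family_F0 :: "'a lr_struct set" where
  "family_F0 = {A. lr_structure A \<and>
     (\<exists>\<C>. finite \<C> \<and> (\<forall>C\<in>\<C>. finite_HLO C) \<and>
          pairwise (\<lambda>C D. disjnt (univ C) (univ D)) \<C> \<and>
          univ A = (\<Union>C\<in>\<C>. univ C) \<and>
          rel_R A = (\<Union>C\<in>\<C>. rel_R C) \<and>
          rel_le A = (\<Union>C\<in>\<C>. rel_le C))}"

text \<open>Epimorphisms between finite structures, which carry the discrete topology.\<close>

definition epimorphism :: "'a lr_struct \<Rightarrow> 'a lr_struct \<Rightarrow> ('a \<Rightarrow> 'a) \<Rightarrow> bool" where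
  "epimorphism A B f \<longleftrightarrow>
     continuous_map (discrete_topology (univ A)) (discrete_topology (univ B)) f \<and>
     f ` univ A = univ B \<and>
     rel_R B = map_prod f f ` rel_R A \<and>
     rel_le B = map_prod f f ` rel_le A"

text \<open>\<open>\<phi> n m\<close> is the bonding map from \<open>P m\<close> to \<open>P n\<close>; its values are only relevant for
  \<open>n \<le> m\<close> and on \<open>univ (P m)\<close>.\<close>

definition projective_sequence ::
  "(nat \<Rightarrow> 'a lr_struct) \<Rightarrow> (nat \<Rightarrow> nat \<Rightarrow> 'a \<Rightarrow> 'a) \<Rightarrow> bool" where
  "projective_sequence P \<phi> \<longleftrightarrow>
     (\<forall>n. lr_structure (P n)) \<and>
     (\<forall>n. epimorphism (P (Suc n)) (P n) (\<phi> n (Suc n))) \<and>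
     (\<forall>n. \<forall>x\<in>univ (P n). \<phi> n n x = x) \<and>
     (\<forall>n m. n \<le> m \<longrightarrow>
        (\<forall>x\<in>univ (P (Suc m)). \<phi> n (Suc m) x = \<phi> n m (\<phi> m (Suc m) x)))"

definition proj_limit ::
  "(nat \<Rightarrow> 'a lr_struct) \<Rightarrow> (nat \<Rightarrow> nat \<Rightarrow> 'a \<Rightarrow> 'a) \<Rightarrow> (nat \<Rightarrow> 'a) set" where
  "proj_limit P \<phi> = {u \<in> (\<Pi>\<^sub>E n\<in>UNIV. univ (P n)). \<forall>n. u n = \<phi> n (Suc n) (u (Suc n))}"

definition limit_topology ::
  "(nat \<Rightarrow> 'a lr_struct) \<Rightarrow> (nat \<Rightarrow> nat \<Rightarrow> 'a \<Rightarrow> 'a) \<Rightarrow> (nat \<Rightarrow> 'a) topology" where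
  "limit_topology P \<phi> =
     subtopology (product_topology (\<lambda>n. discrete_topology (univ (P n))) UNIV) (proj_limit P \<phi>)"

definition limit_R ::
  "(nat \<Rightarrow> 'a lr_struct) \<Rightarrow> (nat \<Rightarrow> nat \<Rightarrow> 'a \<Rightarrow> 'a) \<Rightarrow> ((nat \<Rightarrow> 'a) \<times> (nat \<Rightarrow> 'a)) set" where
  "limit_R P \<phi> = {(u, v) \<in> proj_limit P \<phi> \<times> proj_limit P \<phi>. \<forall>n. (u n, v n) \<in> rel_R (P n)}"

definition limit_le ::
  "(nat \<Rightarrow> 'a lr_struct) \<Rightarrow> (nat \<Rightarrow> nat \<Rightarrow> 'a \<Rightarrow> 'a) \<Rightarrow> ((nat \<Rightarrow> 'a) \<times> (nat \<Rightarrow> 'a)) set" where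
  "limit_le P \<phi> = {(u, v) \<in> proj_limit P \<phi> \<times> proj_limit P \<phi>. \<forall>n. (u n, v n) \<in> rel_le (P n)}"

definition fine_sequence ::
  "(nat \<Rightarrow> 'a lr_struct) \<Rightarrow> (nat \<Rightarrow> nat \<Rightarrow> 'a \<Rightarrow> 'a) \<Rightarrow> bool" where
  "fine_sequence P \<phi> \<longleftrightarrow> projective_sequence P \<phi> \<and> equiv (proj_limit P \<phi>) (limit_R P \<phi>)"

definition quotient_topology :: "'a topology \<Rightarrow> ('a \<Rightarrow> 'b) \<Rightarrow> 'b topology" where
  "quotient_topology X q =
     topology (\<lambda>U. U \<subseteq> q ` topspace X \<and> openin X {x \<in> topspace X. q x \<in> U})"

lemma openin_quotient_topology:
  "openin (quotient_topology X q) U \<longleftrightarrow>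
     U \<subseteq> q ` topspace X \<and> openin X {x \<in> topspace X. q x \<in> U}"
proof -
  have "istopology (\<lambda>U. U \<subseteq> q ` topspace X \<and> openin X {x \<in> topspace X. q x \<in> U})"
    unfolding istopology_def
  proof (rule conjI; intro allI impI conjI)
    fix S T
    assume "S \<subseteq> q ` topspace X \<and> openin X {x \<in> topspace X. q x \<in> S}"
      and "T \<subseteq> q ` topspace X \<and> openin X {x \<in> topspace X. q x \<in> T}"
    moreover have "{x \<in> topspace X. q x \<in> S \<inter> T} =
        {x \<in> topspace X. q x \<in> S} \<inter> {x \<in> topspace X. q x \<in> T}" by auto
    ultimately show "S \<inter> T \<subseteq> q ` topspace X" "openin X {x \<in> topspace X. q x \<in> S \<inter> T}"
      by auto
  next
    fix K
    assume K: "\<forall>S\<in>K. S \<subseteq> q ` topspace X \<and> openin X {x \<in> topspace X. q x \<in> S}"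
    then show "\<Union>K \<subseteq> q ` topspace X" by blast
    have "{x \<in> topspace X. q x \<in> \<Union>K} = (\<Union>S\<in>K. {x \<in> topspace X. q x \<in> S})" by auto
    with K show "openin X {x \<in> topspace X. q x \<in> \<Union>K}" by auto
  qed
  then show ?thesis by (simp add: quotient_topology_def topology_inverse')
qed

lemma topspace_quotient_topology: "topspace (quotient_topology X q) = q ` topspace X"
proof (rule subset_antisym)
  show "topspace (quotient_topology X q) \<subseteq> q ` topspace X"
    using openin_quotient_topology[of X q "topspace (quotient_topology X q)"] by simp
  have "{x \<in> topspace X. q x \<in> q ` topspace X} = topspace X" by auto
  then have "openin (quotient_topology X q) (q ` topspace X)"
    by (simp add: openin_quotient_topology)
  then show "q ` topspace X \<subseteq> topspace (quotient_topology X q)"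
    by (rule openin_subset)
qed

lemma quotient_map_quotient_topology: "quotient_map X (quotient_topology X q) q"
  by (auto simp: quotient_map_def topspace_quotient_topology openin_quotient_topology)

definition limit_proj ::
  "(nat \<Rightarrow> 'a lr_struct) \<Rightarrow> (nat \<Rightarrow> nat \<Rightarrow> 'a \<Rightarrow> 'a) \<Rightarrow> (nat \<Rightarrow> 'a) \<Rightarrow> (nat \<Rightarrow> 'a) set" where
  "limit_proj P \<phi> u = limit_R P \<phi> `` {u}"

definition limit_quotient ::
  "(nat \<Rightarrow> 'a lr_struct) \<Rightarrow> (nat \<Rightarrow> nat \<Rightarrow> 'a \<Rightarrow> 'a) \<Rightarrow> (nat \<Rightarrow> 'a) set topology" where
  "limit_quotient P \<phi> = quotient_topology (limit_topology P \<phi>) (limit_proj P \<phi>)"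

definition quotient_le ::
  "(nat \<Rightarrow> 'a lr_struct) \<Rightarrow> (nat \<Rightarrow> nat \<Rightarrow> 'a \<Rightarrow> 'a) \<Rightarrow> ((nat \<Rightarrow> 'a) set \<times> (nat \<Rightarrow> 'a) set) set" where
  "quotient_le P \<phi> = map_prod (limit_proj P \<phi>) (limit_proj P \<phi>) ` limit_le P \<phi>"

lemma topspace_limit_topology: "topspace (limit_topology P \<phi>) = proj_limit P \<phi>"
  by (auto simp: limit_topology_def proj_limit_def)

lemma topspace_limit_quotient:
  "topspace (limit_quotient P \<phi>) = proj_limit P \<phi> // limit_R P \<phi>"
  by (auto simp: limit_quotient_def topspace_quotient_topology topspace_limit_topology
      limit_proj_def quotient_def)

definition maximal_chains :: "('a \<times> 'a) set \<Rightarrow> 'a set set" where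
  "maximal_chains r = {C \<in> Chains r. \<forall>D\<in>Chains r. C \<subseteq> D \<longrightarrow> D = C}"

definition arc_in :: "'a topology \<Rightarrow> 'a set \<Rightarrow> bool" where
  "arc_in X C \<longleftrightarrow>
     C \<subseteq> topspace X \<and> subtopology X C homeomorphic_space top_of_set {0..1::real}"

definition fence :: "'a topology \<Rightarrow> bool" where
  "fence X \<longleftrightarrow> compact_space X \<and> metrizable_space X \<and>
     (\<forall>C\<in>connected_components_of X. (\<exists>x. C = {x}) \<or> arc_in X C)"

definition smooth_fence :: "'a topology \<Rightarrow> bool" where
  "smooth_fence X \<longleftrightarrow> fence X \<and>
     (\<exists>r. partial_order_on (topspace X) r \<and> closedin (prod_topology X X) r \<and>
          (\<forall>C\<in>connected_components_of X. total_on C r))"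

end

theory Submission
  imports Defs
begin

text \<open>
  Comparability in a structure of \<open>\<F>\<^sub>0\<close> is an equivalence relation, and this passes to the limit
  \<open>\<P>\<close>, where its classes are the maximal chains. Since \<open>R\<close> is transitive in the limit, its classes
  are order convex with at most two elements, and \<open>\<le>\<close> descends to a partial order of the quotient.

  For topology, call a set a level downset if it is a downset already at some finite level. If
  \<open>A\<close>, \<open>B\<close> are such sets and \<open>R[A] \<subseteq> B\<close>, transitivity of \<open>R\<close> and compactness allow interpolating a
  third one, so Urysohn's construction yields continuous, monotone, \<open>R\<close>-invariant functions into the
  unit interval. Countably many of them separate the \<open>R\<close>-classes. They embed the quotient into a
  countable power of the unit interval, so it is metrizable; a weighted sum of them is injective on
  the image of each maximal chain.

  A maximal chain has connected image: by a discrete intermediate value theorem for epimorphisms its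
  projections to the finite levels are intervals, so two closed sets covering it contain points
  adjacent at every level and, by compactness, \<open>R\<close>-related points. Distinct maximal chains
  are separated by clopen sets, the preimages of the maximal chains at finite levels. Hence the
  connected components are these images, and a nondegenerate one is homeomorphic to a compact
  interval by the weighted sum.
\<close>

section \<open>Finite structures\<close>

text \<open>The relations of a piece live on its carrier and the carriers are disjoint, so a pair
  with one end in \<open>C\<close> can only come from \<open>C\<close>. Claims about pairs that
  touch a given element can thus be checked inside a single linear order.\<close>

lemma family_F0_block:
  assumes "A \<in> family_F0" "a \<in> univ A"
  shows "\<exists>C. finite_HLO C \<and> a \<in> univ C \<and>
    (\<forall>x y. x \<in> univ C \<or> y \<in> univ C \<longrightarrow>
      ((x, y) \<in> rel_le A \<longleftrightarrow> (x, y) \<in> rel_le C) \<and> ((x, y) \<in> rel_R A \<longleftrightarrow> (x, y) \<in> rel_R C))"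
proof -
  obtain \<C> where \<C>: "\<forall>C\<in>\<C>. finite_HLO C"
    "pairwise (\<lambda>C D. disjnt (univ C) (univ D)) \<C>"
    "univ A = (\<Union>C\<in>\<C>. univ C)" "rel_R A = (\<Union>C\<in>\<C>. rel_R C)" "rel_le A = (\<Union>C\<in>\<C>. rel_le C)"
    using assms(1) unfolding family_F0_def by blast
  obtain C where C: "C \<in> \<C>" "a \<in> univ C" using assms(2) \<C>(3) by blast
  have sub: "rel_R D \<subseteq> univ D \<times> univ D \<and> rel_le D \<subseteq> univ D \<times> univ D" if "D \<in> \<C>" for D
    using bspec[OF \<C>(1) that] unfolding finite_HLO_def finite_HPO_def lr_structure_def by auto
  have uniq: "D = C" if "D \<in> \<C>" "x \<in> univ C" "x \<in> univ D" for D x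
    using \<C>(2) C that unfolding pairwise_def disjnt_def by blast
  have "(x, y) \<in> rel_le A \<longleftrightarrow> (x, y) \<in> rel_le C" if "x \<in> univ C \<or> y \<in> univ C" for x y
    using that sub uniq C(1) unfolding \<C>(5) by blast
  moreover have "(x, y) \<in> rel_R A \<longleftrightarrow> (x, y) \<in> rel_R C" if "x \<in> univ C \<or> y \<in> univ C" for x y
    using that sub uniq C(1) unfolding \<C>(4) by blast
  ultimately show ?thesis using C \<C>(1) by blast
qed

lemma family_F0_carrier:
  assumes "A \<in> family_F0"
  shows "finite (univ A)" "univ A \<noteq> {}" "(a, b) \<in> rel_le A \<Longrightarrow> a \<in> univ A \<and> b \<in> univ A"
    "(a, b) \<in> rel_R A \<Longrightarrow> a \<in> univ A \<and> b \<in> univ A"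
proof -
  have "lr_structure A" using assms unfolding family_F0_def by blast
  then show "univ A \<noteq> {}" "(a, b) \<in> rel_le A \<Longrightarrow> a \<in> univ A \<and> b \<in> univ A"
    "(a, b) \<in> rel_R A \<Longrightarrow> a \<in> univ A \<and> b \<in> univ A"
    unfolding lr_structure_def by blast+
  obtain \<C> where \<C>: "finite \<C>" "\<forall>C\<in>\<C>. finite_HLO C" "univ A = (\<Union>C\<in>\<C>. univ C)"
    using assms unfolding family_F0_def by blast
  have "finite (univ C)" if "C \<in> \<C>" for C
    using bspec[OF \<C>(2) that] unfolding finite_HLO_def finite_HPO_def by simp
  then show "finite (univ A)" using \<C>(1,3) by simp
qed

lemma finite_HLO_order:
  assumes "finite_HLO C"
  shows "a \<in> univ C \<Longrightarrow> (a, a) \<in> rel_le C"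
    "(a, b) \<in> rel_le C \<Longrightarrow> (b, c) \<in> rel_le C \<Longrightarrow> (a, c) \<in> rel_le C"
    "(a, b) \<in> rel_le C \<Longrightarrow> (b, a) \<in> rel_le C \<Longrightarrow> a = b"
    "a \<in> univ C \<Longrightarrow> b \<in> univ C \<Longrightarrow> (a, b) \<in> rel_le C \<or> (b, a) \<in> rel_le C"
    "(a, b) \<in> rel_le C \<Longrightarrow> a \<in> univ C \<and> b \<in> univ C"
proof -
  have r: "refl_on (univ C) (rel_le C)" and t: "trans (rel_le C)" and a: "antisym (rel_le C)"
    and tot: "total_on (univ C) (rel_le C)" and sub: "rel_le C \<subseteq> univ C \<times> univ C"
    using assms unfolding finite_HLO_def finite_HPO_def lr_structure_def partial_order_on_def preorder_on_def
    by simp_all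
  show refl: "a \<in> univ C \<Longrightarrow> (a, a) \<in> rel_le C" for a
    by (rule refl_onD[OF r])
  show "(a, b) \<in> rel_le C \<Longrightarrow> (b, c) \<in> rel_le C \<Longrightarrow> (a, c) \<in> rel_le C"
    by (rule transD[OF t])
  show "(a, b) \<in> rel_le C \<Longrightarrow> (b, a) \<in> rel_le C \<Longrightarrow> a = b"
    by (rule antisymD[OF a])
  show "a \<in> univ C \<Longrightarrow> b \<in> univ C \<Longrightarrow> (a, b) \<in> rel_le C \<or> (b, a) \<in> rel_le C"
    using tot refl unfolding total_on_def by metis
  show "(a, b) \<in> rel_le C \<Longrightarrow> a \<in> univ C \<and> b \<in> univ C"
    using sub by blast
qed

text \<open>The compared elements all lie in the piece of one of them, so everything is inherited
  from a linear order. Transitivity of comparability is special to disjoint unions of chains and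
  makes chains behave like equivalence classes.\<close>

lemma family_F0_order:
  assumes A: "A \<in> family_F0"
  shows family_F0_refl: "a \<in> univ A \<Longrightarrow> (a, a) \<in> rel_le A"
    and family_F0_trans: "(a, b) \<in> rel_le A \<Longrightarrow> (b, c) \<in> rel_le A \<Longrightarrow> (a, c) \<in> rel_le A"
    and family_F0_antisym: "(a, b) \<in> rel_le A \<Longrightarrow> (b, a) \<in> rel_le A \<Longrightarrow> a = b"
    and family_F0_comparable_trans:
      "(a, b) \<in> rel_le A \<or> (b, a) \<in> rel_le A \<Longrightarrow> (b, c) \<in> rel_le A \<or> (c, b) \<in> rel_le A
       \<Longrightarrow> (a, c) \<in> rel_le A \<or> (c, a) \<in> rel_le A"
proof -
  \<comment> \<open>The four claims are bundled around one element \<open>b\<close> that is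
    comparable to all others involved, so that its piece serves them all.\<close>
  have *: "(b \<in> univ A \<longrightarrow> (b, b) \<in> rel_le A) \<and>
    ((a, b) \<in> rel_le A \<longrightarrow> (b, c) \<in> rel_le A \<longrightarrow> (a, c) \<in> rel_le A) \<and>
    ((a, b) \<in> rel_le A \<longrightarrow> (b, a) \<in> rel_le A \<longrightarrow> a = b) \<and>
    ((a, b) \<in> rel_le A \<or> (b, a) \<in> rel_le A \<longrightarrow> (b, c) \<in> rel_le A \<or> (c, b) \<in> rel_le A
       \<longrightarrow> (a, c) \<in> rel_le A \<or> (c, a) \<in> rel_le A)" if b: "b \<in> univ A" for a b c
  proof -
    obtain C where C: "finite_HLO C" "b \<in> univ C"
      "\<And>x y. x \<in> univ C \<or> y \<in> univ C \<Longrightarrow> (x, y) \<in> rel_le A \<longleftrightarrow> (x, y) \<in> rel_le C"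
      using family_F0_block[OF A b] by blast
    note ord = finite_HLO_order[OF C(1)]
    have eq: "(b, x) \<in> rel_le A \<longleftrightarrow> (b, x) \<in> rel_le C" "(x, b) \<in> rel_le A \<longleftrightarrow> (x, b) \<in> rel_le C" for x
      by (simp_all add: C(2,3))
    have mem: "(b, x) \<in> rel_le C \<Longrightarrow> x \<in> univ C" "(x, b) \<in> rel_le C \<Longrightarrow> x \<in> univ C" for x
      using ord(5) by blast+
    have tr: "(a, b) \<in> rel_le A \<longrightarrow> (b, c) \<in> rel_le A \<longrightarrow> (a, c) \<in> rel_le A"
      using eq(2)[of a] eq(1)[of c] mem(2)[of a] ord(2)[of a b c] C(3)[of a c] by simp
    have co: "a \<in> univ C \<Longrightarrow> c \<in> univ C \<Longrightarrow> (a, c) \<in> rel_le A \<or> (c, a) \<in> rel_le A"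
      using ord(4)[of a c] C(3)[of a c] C(3)[of c a] by blast
    show ?thesis using ord(1)[OF C(2)] ord(3)[of a b] tr co eq[of a] eq[of b] eq[of c] mem[of a] mem[of c] by auto
  qed
  note carrier = family_F0_carrier(3)[OF A]
  show "(a, a) \<in> rel_le A" if "a \<in> univ A"
    using * that by blast
  show "(a, c) \<in> rel_le A" if "(a, b) \<in> rel_le A" "(b, c) \<in> rel_le A"
    using *[of b a c] carrier[OF that(1)] that by simp
  show "a = b" if "(a, b) \<in> rel_le A" "(b, a) \<in> rel_le A"
    using *[of b a a] carrier[OF that(1)] that by simp
  have "b \<in> univ A" if "(a, b) \<in> rel_le A \<or> (b, a) \<in> rel_le A"
    using carrier that by blast
  then show "(a, c) \<in> rel_le A \<or> (c, a) \<in> rel_le A"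
    if "(a, b) \<in> rel_le A \<or> (b, a) \<in> rel_le A" "(b, c) \<in> rel_le A \<or> (c, b) \<in> rel_le A"
    using *[of b a c] that by simp
qed

lemma family_F0_R_iff:
  assumes A: "A \<in> family_F0" and ab: "a \<in> univ A" "b \<in> univ A"
  shows "(a, b) \<in> rel_R A \<longleftrightarrow>
    a = b \<or> immediate_successor (rel_le A) a b \<or> immediate_successor (rel_le A) b a"
proof -
  obtain C where C: "finite_HLO C" "a \<in> univ C"
    "\<And>x y. x \<in> univ C \<or> y \<in> univ C \<Longrightarrow> (x, y) \<in> rel_le A \<longleftrightarrow> (x, y) \<in> rel_le C"
    "\<And>x y. x \<in> univ C \<or> y \<in> univ C \<Longrightarrow> (x, y) \<in> rel_R A \<longleftrightarrow> (x, y) \<in> rel_R C"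
    using family_F0_block[OF A ab(1)] by blast
  have sub: "rel_R C \<subseteq> univ C \<times> univ C" "rel_le C \<subseteq> univ C \<times> univ C"
    using C(1) unfolding finite_HLO_def finite_HPO_def lr_structure_def by auto
  have R: "(a, b) \<in> rel_R C \<longleftrightarrow>
    a = b \<or> immediate_successor (rel_le C) a b \<or> immediate_successor (rel_le C) b a"
    if "b \<in> univ C"
    using C(1,2) that unfolding finite_HLO_def finite_HPO_def by simp
  show ?thesis
  proof (cases "b \<in> univ C")
    case True
    have "(a, x) \<in> rel_le A \<longleftrightarrow> (a, x) \<in> rel_le C" "(x, a) \<in> rel_le A \<longleftrightarrow> (x, a) \<in> rel_le C"
      "(b, x) \<in> rel_le A \<longleftrightarrow> (b, x) \<in> rel_le C" "(x, b) \<in> rel_le A \<longleftrightarrow> (x, b) \<in> rel_le C" for x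
      by (simp_all add: C(2,3) True)
    then have "immediate_successor (rel_le A) a b = immediate_successor (rel_le C) a b"
      "immediate_successor (rel_le A) b a = immediate_successor (rel_le C) b a"
      unfolding immediate_successor_def by simp_all
    then show ?thesis using R[OF True] C(2) C(4)[of a b] by simp
  next
    case False
    then have "(a, b) \<notin> rel_R C" "(a, b) \<notin> rel_le C" "(b, a) \<notin> rel_le C" "a \<noteq> b"
      using sub C(2) by blast+
    then show ?thesis using C(2) C(3)[of a b] C(3)[of b a] C(4)[of a b] unfolding immediate_successor_def by simp
  qed
qed

text \<open>The last clause says that nothing lies strictly inside an adjacent pair. It is stated
  without orienting \<open>R\<close>: once \<open>a \<le> c\<close> is known, \<open>a\<close>
  cannot be an immediate successor of \<open>c\<close>, by antisymmetry.\<close>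

lemma family_F0_adjacent:
  assumes A: "A \<in> family_F0"
  shows family_F0_R_refl: "a \<in> univ A \<Longrightarrow> (a, a) \<in> rel_R A"
    and family_F0_R_sym: "(a, b) \<in> rel_R A \<Longrightarrow> (b, a) \<in> rel_R A"
    and family_F0_R_comparable: "(a, b) \<in> rel_R A \<Longrightarrow> (a, b) \<in> rel_le A \<or> (b, a) \<in> rel_le A"
    and family_F0_R_between:
      "(a, c) \<in> rel_R A \<Longrightarrow> (a, b) \<in> rel_le A \<Longrightarrow> (b, c) \<in> rel_le A \<Longrightarrow> b = a \<or> b = c"
proof -
  note iff = family_F0_R_iff[OF A] and carrier = family_F0_carrier(4)[OF A]
  show "(a, a) \<in> rel_R A" if "a \<in> univ A"
    using iff that by blast
  show "(b, a) \<in> rel_R A" if "(a, b) \<in> rel_R A"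
    using iff carrier[OF that] that by blast
  show "(a, b) \<in> rel_le A \<or> (b, a) \<in> rel_le A" if "(a, b) \<in> rel_R A"
    using iff carrier[OF that] that family_F0_refl[OF A] unfolding immediate_successor_def by blast
  show "b = a \<or> b = c" if R: "(a, c) \<in> rel_R A" and le: "(a, b) \<in> rel_le A" "(b, c) \<in> rel_le A"
  proof -
    have "(a, c) \<in> rel_le A" by (rule family_F0_trans[OF A le])
    consider "a = c" | "immediate_successor (rel_le A) a c" | "immediate_successor (rel_le A) c a"
      using iff carrier[OF R] R by blast
    then show ?thesis
    proof cases
      case 1
      then show ?thesis using family_F0_antisym[OF A le(1)] le(2) by simp
    next
      case 2
      then show ?thesis using le unfolding immediate_successor_def by simp
    next
      case 3
      then show ?thesis
        using family_F0_antisym[OF A] \<open>(a, c) \<in> rel_le A\<close> unfolding immediate_successor_def by blast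
    qed
  qed
qed

section \<open>Extremal elements and discrete intermediate values\<close>

lemma family_F0_finite_extremal:
  assumes A: "A \<in> family_F0" and S: "finite S" "S \<noteq> {}"
  shows "\<exists>m\<in>S. \<forall>x\<in>S. (x, m) \<in> rel_le A \<longrightarrow> x = m"
    and "\<exists>m\<in>S. \<forall>x\<in>S. (m, x) \<in> rel_le A \<longrightarrow> x = m"
proof -
  let ?r = "\<lambda>x y. (x, y) \<in> rel_le A \<and> x \<noteq> y"
  have "asymp_on S ?r"
    using family_F0_antisym[OF A] unfolding asymp_on_def by blast
  moreover have "transp_on S ?r"
    unfolding transp_on_def using family_F0_antisym[OF A] family_F0_trans[OF A] by metis
  ultimately have "\<exists>m\<in>S. \<forall>x\<in>S. x \<noteq> m \<longrightarrow> \<not> ?r x m" "\<exists>m\<in>S. \<forall>x\<in>S. x \<noteq> m \<longrightarrow> \<not> ?r m x"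
    by (rule Finite_Set.bex_min_element[OF S(1) _ _ S(2)], rule Finite_Set.bex_max_element[OF S(1) _ _ S(2)])
  then show "\<exists>m\<in>S. \<forall>x\<in>S. (x, m) \<in> rel_le A \<longrightarrow> x = m" "\<exists>m\<in>S. \<forall>x\<in>S. (m, x) \<in> rel_le A \<longrightarrow> x = m"
    by blast+
qed

text \<open>A minimal element of the interval between \<open>a\<close> (excluded) and
  \<open>b\<close> (included) has nothing between it and \<open>a\<close>.\<close>

lemma family_F0_successor:
  assumes A: "A \<in> family_F0" and ab: "(a, b) \<in> rel_le A" "a \<noteq> b"
  obtains c where "(a, c) \<in> rel_le A" "(c, b) \<in> rel_le A" "c \<noteq> a" "(a, c) \<in> rel_R A"
proof -
  let ?S = "{x \<in> univ A. (a, x) \<in> rel_le A \<and> (x, b) \<in> rel_le A \<and> x \<noteq> a}"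
  have "b \<in> ?S" using ab family_F0_carrier(3)[OF A] family_F0_refl[OF A] by blast
  moreover have "finite ?S" using family_F0_carrier(1)[OF A] by simp
  ultimately obtain c where c: "c \<in> ?S" "\<forall>x\<in>?S. (x, c) \<in> rel_le A \<longrightarrow> x = c"
    using family_F0_finite_extremal(1)[OF A, of ?S] by blast
  then have "immediate_successor (rel_le A) a c"
    using family_F0_trans[OF A] family_F0_carrier(3)[OF A] unfolding immediate_successor_def by blast
  then show thesis using that c family_F0_R_iff[OF A] family_F0_carrier(3)[OF A] by blast
qed

text \<open>Discrete intermediate value theorem. Take \<open>z\<close> maximal in the interval from
  \<open>x\<close> to \<open>y\<close> with \<open>f z \<le> c\<close>. If \<open>f z\<close> were
  not \<open>c\<close>, the successor \<open>d\<close> of \<open>z\<close> towards \<open>y\<close>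
  would be mapped strictly above \<open>c\<close>; but \<open>f z\<close> and \<open>f d\<close> are
  adjacent, so \<open>c\<close> cannot be jumped over.\<close>

lemma epimorphism_intermediate:
  assumes A: "A \<in> family_F0" and B: "B \<in> family_F0" and f: "epimorphism A B f"
    and xy: "(x, y) \<in> rel_le A" and c: "(f x, c) \<in> rel_le B" "(c, f y) \<in> rel_le B"
  obtains z where "(x, z) \<in> rel_le A" "(z, y) \<in> rel_le A" "f z = c"
proof -
  have mono: "(a, b) \<in> rel_le A \<Longrightarrow> (f a, f b) \<in> rel_le B"
    and R: "(a, b) \<in> rel_R A \<Longrightarrow> (f a, f b) \<in> rel_R B" for a b
    using f unfolding epimorphism_def by force+
  let ?S = "{z \<in> univ A. (x, z) \<in> rel_le A \<and> (z, y) \<in> rel_le A \<and> (f z, c) \<in> rel_le B}"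
  have "x \<in> ?S" using xy c family_F0_carrier(3)[OF A] family_F0_refl[OF A] by blast
  moreover have "finite ?S" using family_F0_carrier(1)[OF A] by simp
  ultimately obtain z where z: "z \<in> ?S" "\<forall>w\<in>?S. (z, w) \<in> rel_le A \<longrightarrow> w = z"
    using family_F0_finite_extremal(2)[OF A, of ?S] by blast
  have "f z = c"
  proof (rule ccontr)
    assume ne: "f z \<noteq> c"
    then have "z \<noteq> y" using z c family_F0_antisym[OF B] by blast
    then obtain d where d: "(z, d) \<in> rel_le A" "(d, y) \<in> rel_le A" "d \<noteq> z" "(z, d) \<in> rel_R A"
      using family_F0_successor[OF A] z by blast
    have "(f d, c) \<notin> rel_le B"
      using z d family_F0_trans[OF A] family_F0_carrier(3)[OF A] by blast
    moreover have "(f d, c) \<in> rel_le B \<or> (c, f d) \<in> rel_le B"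
      using family_F0_comparable_trans[OF B] mono[OF d(1)] z by blast
    \<comment> \<open>Both \<open>f d\<close> and \<open>c\<close> are comparable to
      \<open>f z\<close>, hence to each other; since \<open>f d \<le> c\<close> fails, only this
      direction is left.\<close>
    ultimately have "(c, f d) \<in> rel_le B" "c \<noteq> f d" 
      using family_F0_refl[OF B] family_F0_carrier(3)[OF B] c(1) by auto
    then show False using family_F0_R_between[OF B R[OF d(4)]] z ne by blast
  qed
  then show thesis using that z by blast
qed

section \<open>Chains, dyadic families and arcs\<close>

lemma dyadics_dense_unit_interval:
  fixes x y :: real
  assumes "0 \<le> x" "x < y" "y \<le> 1"
  obtains r where "r \<in> dyadics \<inter> {0..1}" "x < r" "r < y"
proof -
  obtain n q r where r: "of_nat q / 2^n \<le> x" "x < of_nat r / (2^n::real)"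
     "\<bar>of_nat q / 2^n - of_nat r / (2^n::real)\<bar> < y - x"
    by (rule padic_rational_approximation_straddle_pos_le[of "y - x" 2 x]) (use assms in auto)
  show thesis
  proof (rule that)
    show "of_nat r / 2^n < y" using r by linarith
    then have "of_nat r / 2^n \<le> (1::real)" using assms(3) by linarith
    then have "of_nat r / 2^n \<in> {0..1::real}" by simp
    then show "of_nat r / 2^n \<in> dyadics \<inter> {0..1::real}"
      unfolding dyadics_def by blast
  qed (use r in simp)
qed

text \<open>Urysohn's function for a family of clopen sets: its strict sublevel sets are unions of
  sets \<open>G r\<close>, its strict superlevel sets unions of complements. The two one-sided
  bounds are all that later arguments need to recover values, monotonicity and invariance.\<close>

lemma dyadic_clopen_family_function:
  fixes G :: "real \<Rightarrow> 'a set"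
  assumes clopen: "\<And>r. r \<in> dyadics \<inter> {0..1} \<Longrightarrow> closedin X (G r) \<and> openin X (G r)"
    and mono: "\<And>r s. r \<in> dyadics \<inter> {0..1} \<Longrightarrow> s \<in> dyadics \<inter> {0..1} \<Longrightarrow> r < s \<Longrightarrow> G r \<subseteq> G s"
  shows "\<exists>f. continuous_map X euclideanreal f \<and> (\<forall>x. f x \<in> {0..1}) \<and>
    (\<forall>r\<in>dyadics \<inter> {0..1}. \<forall>x. (x \<in> G r \<longrightarrow> f x \<le> r) \<and> (x \<notin> G r \<longrightarrow> r \<le> f x))"
proof -
  \<comment> \<open>The added 1 keeps the set nonempty and is the value at points outside every
    \<open>G r\<close>.\<close>
  define f where "f x = Inf (insert 1 {r \<in> dyadics \<inter> {0..1}. x \<in> G r})" for x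
  have f01: "f x \<in> {0..1}" for x
  proof -
    have "0 \<le> f x" unfolding f_def by (rule cInf_greatest) auto
    moreover have "f x \<le> 1" unfolding f_def by (rule cInf_lower) (auto intro: bdd_belowI[of _ 0])
    ultimately show ?thesis by simp
  qed
  have le: "f x \<le> r" if "r \<in> dyadics \<inter> {0..1}" "x \<in> G r" for r x
    unfolding f_def by (rule cInf_lower) (use that in \<open>auto intro: bdd_belowI[of _ 0]\<close>)
  have ge: "r \<le> f x" if "r \<in> dyadics \<inter> {0..1}" "x \<notin> G r" for r x
    unfolding f_def
  proof (rule cInf_greatest)
    fix s assume "s \<in> insert 1 {r \<in> dyadics \<inter> {0..1}. x \<in> G r}"
    then show "r \<le> s" using mono[of s r] that by force
  qed simp
  have gt: "openin X {x \<in> topspace X. f x > a}" for a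
  proof (cases "a < 0")
    \<comment> \<open>Negative \<open>a\<close> must be split off: points that belong to every
      \<open>G r\<close> lie in no complement, so the union used in the other case would miss
      them.\<close>
    case True
    then have "f x > a" for x using f01[of x] by simp
    then have "{x \<in> topspace X. f x > a} = topspace X" by simp
    then show ?thesis by simp
  next
    case False
    have "\<exists>r\<in>dyadics \<inter> {0..1}. a < r \<and> x \<notin> G r" if ax: "a < f x" for x
    proof -
      obtain r where "r \<in> dyadics \<inter> {0..1}" "a < r" "r < f x"
        by (rule dyadics_dense_unit_interval[of a "f x"]) (use f01[of x] ax False in auto)
      then show ?thesis using le[of r x] by force
    qed
    moreover have "a < f x" if "r \<in> dyadics \<inter> {0..1}" "a < r" "x \<notin> G r" for x r
      using ge[OF that(1,3)] that(2) by linarith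
    ultimately have "{x \<in> topspace X. f x > a} =
        (\<Union>r\<in>{r \<in> dyadics \<inter> {0..1}. r > a}. topspace X - G r)" by blast
    also have "openin X \<dots>" by (rule openin_Union) (use clopen in blast)
    finally show ?thesis .
  qed
  have lt: "openin X {x \<in> topspace X. f x < a}" for a
  proof (cases "a > 1")
    \<comment> \<open>Likewise, for \<open>a > 1\<close> the union of the sets \<open>G r\<close>
      would miss the points outside all of them.\<close>
    case True
    then have "f x < a" for x using f01[of x] by simp
    then have "{x \<in> topspace X. f x < a} = topspace X" by simp
    then show ?thesis by simp
  next
    case False
    have "\<exists>r\<in>dyadics \<inter> {0..1}. r < a \<and> x \<in> G r" if ax: "f x < a" for x
    proof -
      obtain r where "r \<in> dyadics \<inter> {0..1}" "f x < r" "r < a"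
        by (rule dyadics_dense_unit_interval[of "f x" a]) (use f01[of x] ax False in auto)
      then show ?thesis using ge[of r x] by force
    qed
    moreover have "f x < a" if "r \<in> dyadics \<inter> {0..1}" "r < a" "x \<in> G r" for x r
      using le[OF that(1,3)] that(2) by linarith
    moreover have "G r \<subseteq> topspace X" if "r \<in> dyadics \<inter> {0..1}" for r
      using clopen[OF that] openin_subset by blast
    ultimately have "{x \<in> topspace X. f x < a} = (\<Union>r\<in>{r \<in> dyadics \<inter> {0..1}. r < a}. G r)" by blast
    also have "openin X \<dots>" by (rule openin_Union) (use clopen in blast)
    finally show ?thesis .
  qed
  have "continuous_map X euclideanreal f"
    unfolding continuous_map_upper_lower_semicontinuous_lt using gt lt by blast
  then show ?thesis using f01 le ge by blast
qed

text \<open>If comparability is an equivalence, then a nonempty chain lies in the class of each of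
  its points and every class is a chain. Nonemptiness of \<open>S\<close> prevents the empty chain
  from being maximal.\<close>

lemma maximal_chains_eq_quotient:
  assumes equiv: "equiv S (r \<union> r\<inverse>)" and S: "S \<noteq> {}"
  shows "maximal_chains r = S // (r \<union> r\<inverse>)"
proof -
  define E where "E = r \<union> r\<inverse>"
  have E: "equiv S E" using equiv unfolding E_def .
  have chain: "C \<in> Chains r \<longleftrightarrow> (\<forall>x\<in>C. \<forall>y\<in>C. (x, y) \<in> E)" for C
    unfolding Chains_def E_def by auto
  have class_chain: "E `` {x} \<in> Chains r" for x
    unfolding chain using equivE[OF E] by (metis Image_singleton_iff symD transD)
  have self: "x \<in> E `` {x}" if "x \<in> S" for x
    by (rule equiv_class_self[OF E that])
  have sup: "D \<subseteq> E `` {x}" if "D \<in> Chains r" "x \<in> D" for D x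
    using that unfolding chain by auto
  have "C \<in> S // E" if C: "C \<in> Chains r" "\<forall>D\<in>Chains r. C \<subseteq> D \<longrightarrow> D = C" for C
  proof -
    have "C \<noteq> {}" using C(2) class_chain S self by fastforce
    then obtain x where x: "x \<in> C" by auto
    have eq: "E `` {x} = C" using C(2) class_chain[of x] sup[OF C(1) x] by simp
    have "(x, x) \<in> E" using C(1) x unfolding chain by simp
    then have "x \<in> S" using E unfolding equiv_def by auto
    then show ?thesis unfolding eq[symmetric] by (rule quotientI)
  qed
  moreover have "C \<in> Chains r \<and> (\<forall>D\<in>Chains r. C \<subseteq> D \<longrightarrow> D = C)" if "C \<in> S // E" for C
    using that
  proof (rule quotientE)
    fix x assume x: "C = E `` {x}" "x \<in> S"
    have "D = C" if "D \<in> Chains r" "C \<subseteq> D" for D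
      using sup[OF that(1), of x] self[OF x(2)] that(2) x(1) by auto
    then show ?thesis using class_chain x(1) by simp
  qed
  ultimately show ?thesis unfolding maximal_chains_def E_def[symmetric] by auto
qed

section \<open>From chains to intervals of the real line\<close>

text \<open>Compresses countably many coordinates into one real number. The geometric weights give
  uniform convergence and hence continuity; being positive, they make the sum strictly monotone for
  the pointwise order, hence injective on pointwise chains in \<open>D\<close>.\<close>

lemma geometric_weighted_sum:
  fixes D :: "(nat \<Rightarrow> real) set"
  assumes D: "\<And>y k. y \<in> D \<Longrightarrow> y k \<in> {0..1}"
  shows continuous_on_geometric_weighted_sum: "continuous_on D (\<lambda>y. \<Sum>k. (1/2)^k * y k)"
    and strict_mono_geometric_weighted_sum: "\<lbrakk>y \<in> D; z \<in> D; y \<le> z; y \<noteq> z\<rbrakk>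
      \<Longrightarrow> (\<Sum>k. (1/2)^k * y k) < (\<Sum>k. (1/2)^k * z k)"
proof -
  have bound: "norm ((1/2)^k * y k) \<le> (1/2::real)^k" if "y \<in> D" for y k
    using D[OF that, of k] by (simp add: abs_mult mult_left_le)
  have geo: "summable (\<lambda>k. (1/2::real)^k)" by (simp add: summable_geometric)
  have "uniform_limit D (\<lambda>n y. \<Sum>k<n. (1/2)^k * y k) (\<lambda>y. \<Sum>k. (1/2)^k * y k) sequentially"
    by (rule Weierstrass_m_test[OF bound geo])
  moreover have "continuous_on D (\<lambda>y. \<Sum>k<n. (1/2)^k * y k)" for n
    by (intro continuous_intros continuous_on_subset[OF continuous_on_product_coordinates]) simp
  ultimately show "continuous_on D (\<lambda>y. \<Sum>k. (1/2)^k * y k)"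
    by (intro uniform_limit_theorem[where F = sequentially]) auto
  assume yz: "y \<in> D" "z \<in> D" "y \<le> z" "y \<noteq> z"
  have sm: "summable (\<lambda>k. (1/2)^k * y k)" if "y \<in> D" for y
    by (rule summable_comparison_test'[OF geo, of 0]) (use bound[OF that] in simp)
  obtain k where "y k \<noteq> z k" using yz(4) by (auto simp: fun_eq_iff)
  then have k: "y k < z k" using le_funD[OF yz(3), of k] by simp
  have "0 < (\<Sum>k. (1/2)^k * z k - (1/2)^k * y k)"
  proof (rule suminf_pos2)
    show "summable (\<lambda>k. (1/2)^k * z k - (1/2)^k * y k)" using sm yz by (intro summable_diff) auto
    show "0 \<le> (1/2)^n * z n - (1/2)^n * y n" for n using le_funD[OF yz(3), of n] by simp
    show "0 < (1/2)^k * z k - (1/2)^k * y k" using k by simp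
  qed
  also have "\<dots> = (\<Sum>k. (1/2)^k * z k) - (\<Sum>k. (1/2)^k * y k)"
    using suminf_diff[OF sm sm] yz by simp
  finally show "(\<Sum>k. (1/2)^k * y k) < (\<Sum>k. (1/2)^k * z k)" by simp
qed

text \<open>The image of \<open>C\<close> is compact, connected and has two points, so it is a
  nondegenerate closed interval, which is rescaled to the unit interval. A continuous injection of a
  compact space into a Hausdorff space is an embedding.\<close>

lemma arc_in_if_injective_real_function:
  fixes f :: "'a \<Rightarrow> real"
  assumes C: "compactin X C" "connectedin X C" and xy: "x \<in> C" "y \<in> C" "x \<noteq> y"
    and f: "continuous_map (subtopology X C) euclideanreal f" and inj: "inj_on f C"
  shows "arc_in X C"
proof -
  have sub: "C \<subseteq> topspace X" using C(1) compactin_subset_topspace by blast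
  have comp: "compact_space (subtopology X C)" and con: "connectedin (subtopology X C) C"
    using C by (simp_all add: compact_space_subtopology connectedin_subtopology)
  have "compact (f ` C)"
    using image_compactin[OF _ f, of C] comp sub
    by (simp add: compact_space_def compactin_subtopology C(1))
  moreover have "connected (f ` C)"
    using connectedin_continuous_map_image[OF f con] by simp
  ultimately obtain a b where ab: "f ` C = {a..b}"
    using connected_compact_interval_1[of "f ` C"] by auto
  have "f x \<noteq> f y" "f x \<in> {a..b}" "f y \<in> {a..b}" using inj xy ab unfolding inj_on_def by blast+
  then have lt: "a < b" by auto
  define g where "g = (\<lambda>t. (t - a) / (b - a)) \<circ> f"
  have aff: "(\<lambda>t. (t - a) / (b - a)) ` {a..b} = {0..1}"
  proof (intro subset_antisym subsetI)
    fix s assume "s \<in> {0..1::real}"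
    then have "0 \<le> s * (b - a)" "s * (b - a) \<le> 1 * (b - a)"
      using lt by (auto intro!: mult_nonneg_nonneg mult_right_mono simp del: mult_1)
    then have "a + s * (b - a) \<in> {a..b}" by simp
    moreover have "s = (a + s * (b - a) - a) / (b - a)" using lt by simp
    ultimately show "s \<in> (\<lambda>t. (t - a) / (b - a)) ` {a..b}" by blast
  qed (use lt in \<open>auto simp: field_simps\<close>)
  have "continuous_map (subtopology X C) euclideanreal g"
    unfolding g_def by (rule continuous_map_compose[OF f]) (use lt in \<open>auto intro!: continuous_intros\<close>)
  moreover have "inj_on g C" using inj lt unfolding g_def inj_on_def by simp
  ultimately have "embedding_map (subtopology X C) euclideanreal g"
    by (intro continuous_imp_embedding_map comp) (use sub in \<open>simp_all add: topspace_subtopology_subset Int_absorb1\<close>)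
  then have "subtopology X C homeomorphic_space top_of_set (g ` C)"
    using embedding_map_imp_homeomorphic_space sub by (metis topspace_subtopology_subset)
  moreover have "g ` C = {0..1}" unfolding g_def image_comp[symmetric] ab aff ..
  ultimately show ?thesis unfolding arc_in_def using sub by simp
qed

section \<open>The projective limit\<close>

locale fine_F0_sequence =
  fixes P :: "nat \<Rightarrow> 'a lr_struct" and \<phi> :: "nat \<Rightarrow> nat \<Rightarrow> 'a \<Rightarrow> 'a"
  assumes fine: "fine_sequence P \<phi>" and F0: "\<And>n. P n \<in> family_F0"
begin

abbreviation L where "L \<equiv> proj_limit P \<phi>"
abbreviation LE where "LE \<equiv> limit_le P \<phi>"
abbreviation RR where "RR \<equiv> limit_R P \<phi>"
abbreviation T where "T \<equiv> limit_topology P \<phi>"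

lemma proj_seq: "projective_sequence P \<phi>"
  using fine unfolding fine_sequence_def by simp

lemma equiv_R: "equiv L RR"
  using fine unfolding fine_sequence_def by simp

lemma epi: "epimorphism (P (Suc n)) (P n) (\<phi> n (Suc n))"
  using proj_seq unfolding projective_sequence_def by blast

lemma bond_image: "\<phi> n (Suc n) ` univ (P (Suc n)) = univ (P n)"
  using epi[of n] unfolding epimorphism_def by simp

lemma bond_mono: "(a, b) \<in> rel_le (P (Suc n)) \<Longrightarrow> (\<phi> n (Suc n) a, \<phi> n (Suc n) b) \<in> rel_le (P n)"
  using epi[of n] unfolding epimorphism_def by auto

lemma bond_R: "(a, b) \<in> rel_R (P (Suc n)) \<Longrightarrow> (\<phi> n (Suc n) a, \<phi> n (Suc n) b) \<in> rel_R (P n)"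
  using epi[of n] unfolding epimorphism_def by auto

lemma bond_id: "x \<in> univ (P n) \<Longrightarrow> \<phi> n n x = x"
  using proj_seq unfolding projective_sequence_def by blast

lemma bond_Suc: "n \<le> m \<Longrightarrow> x \<in> univ (P (Suc m)) \<Longrightarrow> \<phi> n (Suc m) x = \<phi> n m (\<phi> m (Suc m) x)"
  using proj_seq unfolding projective_sequence_def by blast

lemma bond_in: "n \<le> m \<Longrightarrow> x \<in> univ (P m) \<Longrightarrow> \<phi> n m x \<in> univ (P n)"
proof (induction m arbitrary: x rule: dec_induct)
  case base
  then show ?case by (simp add: bond_id)
next
  case (step m)
  have "\<phi> m (Suc m) x \<in> univ (P m)" using step.prems unfolding bond_image[of m, symmetric] by blast
  then show ?case unfolding bond_Suc[OF step.hyps(1) step.prems] by (rule step.IH)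
qed

text \<open>The definition of a projective sequence splits off the bonding map nearest to
  \<open>m\<close>. Splitting off the one nearest to \<open>n\<close> shows that the images of a
  point of level \<open>m\<close> satisfy the thread condition.\<close>

lemma bond_comp:
  "Suc n \<le> m \<Longrightarrow> x \<in> univ (P m) \<Longrightarrow> \<phi> n m x = \<phi> n (Suc n) (\<phi> (Suc n) m x)"
proof (induction m arbitrary: x rule: dec_induct)
  case base
  then show ?case by (simp add: bond_id)
next
  case (step m)
  have "\<phi> m (Suc m) x \<in> univ (P m)" using step.prems unfolding bond_image[of m, symmetric] by blast
  then have "\<phi> n m (\<phi> m (Suc m) x) = \<phi> n (Suc n) (\<phi> (Suc n) m (\<phi> m (Suc m) x))"
    by (rule step.IH)
  moreover have "n \<le> m" using step.hyps(1) by simp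
  ultimately show ?case
    unfolding bond_Suc[OF step.hyps(1) step.prems] by (simp only: bond_Suc[OF \<open>n \<le> m\<close> step.prems])
qed

section \<open>Threads and the relations between them\<close>

lemma limit_in: "u \<in> L \<Longrightarrow> u n \<in> univ (P n)"
  unfolding proj_limit_def by blast

lemma limit_step:
  assumes "u \<in> L"
  shows "\<phi> n (Suc n) (u (Suc n)) = u n"
proof -
  have "\<forall>n. u n = \<phi> n (Suc n) (u (Suc n))" using assms unfolding proj_limit_def by blast
  from spec[OF this, of n] show ?thesis by (rule sym)
qed

lemma limitI:
  assumes "\<And>n. u n \<in> univ (P n)" "\<And>n. \<phi> n (Suc n) (u (Suc n)) = u n"
  shows "u \<in> L"
proof -
  have "u \<in> (\<Pi>\<^sub>E n\<in>UNIV. univ (P n))" by (simp add: assms(1) PiE_iff)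
  moreover have "\<forall>n. u n = \<phi> n (Suc n) (u (Suc n))" by (intro allI sym[OF assms(2)])
  ultimately show ?thesis unfolding proj_limit_def by blast
qed

text \<open>Used mostly in contraposed form: once a relation fails between two threads at some
  level, it fails at all later levels.\<close>

lemma level_le:
  assumes "u \<in> L" "v \<in> L" "n \<le> m" "(u m, v m) \<in> rel_le (P m)"
  shows "(u n, v n) \<in> rel_le (P n)"
  using assms(3,4)
proof (induction m rule: dec_induct)
  case (step m)
  have "(u m, v m) \<in> rel_le (P m)"
    using bond_mono[OF step.prems] limit_step[OF assms(1)] limit_step[OF assms(2)] by simp
  then show ?case by (rule step.IH)
qed

lemma level_R:
  assumes "u \<in> L" "v \<in> L" "n \<le> m" "(u m, v m) \<in> rel_R (P m)"
  shows "(u n, v n) \<in> rel_R (P n)"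
  using assms(3,4)
proof (induction m rule: dec_induct)
  case (step m)
  have "(u m, v m) \<in> rel_R (P m)"
    using bond_R[OF step.prems] limit_step[OF assms(1)] limit_step[OF assms(2)] by simp
  then show ?case by (rule step.IH)
qed

lemma level_eq:
  assumes "u \<in> L" "v \<in> L" "n \<le> m" "u m = v m"
  shows "u n = v n"
  using assms(3,4)
proof (induction m rule: dec_induct)
  case (step m)
  have "u m = v m"
    using step.prems limit_step[OF assms(1), of m] limit_step[OF assms(2), of m] by simp
  then show ?case by (rule step.IH)
qed

lemma limit_le_iff: "(u, v) \<in> LE \<longleftrightarrow> u \<in> L \<and> v \<in> L \<and> (\<forall>n. (u n, v n) \<in> rel_le (P n))"
  unfolding limit_le_def by auto

lemma limit_leD:
  assumes "(u, v) \<in> LE"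
  shows "u \<in> L" "v \<in> L" "(u n, v n) \<in> rel_le (P n)"
  using assms by (simp_all add: limit_le_iff)

lemma limit_R_iff: "(u, v) \<in> RR \<longleftrightarrow> u \<in> L \<and> v \<in> L \<and> (\<forall>n. (u n, v n) \<in> rel_R (P n))"
  unfolding limit_R_def by auto

lemma limit_RD:
  assumes "(u, v) \<in> RR"
  shows "u \<in> L" "v \<in> L" "(u n, v n) \<in> rel_R (P n)"
  using assms by (simp_all add: limit_R_iff)

lemma limit_R_refl: "u \<in> L \<Longrightarrow> (u, u) \<in> RR"
  using equiv_R unfolding equiv_def refl_on_def by blast

lemma limit_R_sym: "(u, v) \<in> RR \<Longrightarrow> (v, u) \<in> RR"
  using equiv_R unfolding equiv_def sym_def by blast

lemma limit_R_trans: "(u, v) \<in> RR \<Longrightarrow> (v, w) \<in> RR \<Longrightarrow> (u, w) \<in> RR"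
  using equiv_R unfolding equiv_def trans_def by blast

lemma limit_le_refl: "u \<in> L \<Longrightarrow> (u, u) \<in> LE"
  by (simp add: limit_le_iff family_F0_refl[OF F0] limit_in)

lemma limit_le_trans: "(u, v) \<in> LE \<Longrightarrow> (v, w) \<in> LE \<Longrightarrow> (u, w) \<in> LE"
  by (auto simp: limit_le_iff intro: family_F0_trans[OF F0])

lemma limit_le_antisym: "(u, v) \<in> LE \<Longrightarrow> (v, u) \<in> LE \<Longrightarrow> u = v"
  by (rule ext, rule family_F0_antisym[OF F0]) (auto simp: limit_le_iff)

text \<open>The direction of comparison cannot alternate: if \<open>u \<le> v\<close> fails at level
  \<open>n\<close>, it fails at all later levels, so \<open>v \<le> u\<close> holds there and
  descends to every level.\<close>

lemma limit_comparable_iff: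
  "(u, v) \<in> LE \<union> LE\<inverse> \<longleftrightarrow>
    u \<in> L \<and> v \<in> L \<and> (\<forall>n. (u n, v n) \<in> rel_le (P n) \<or> (v n, u n) \<in> rel_le (P n))"
proof
  assume "(u, v) \<in> LE \<union> LE\<inverse>"
  then show "u \<in> L \<and> v \<in> L \<and> (\<forall>n. (u n, v n) \<in> rel_le (P n) \<or> (v n, u n) \<in> rel_le (P n))"
    by (auto simp: limit_le_iff)
next
  assume *: "u \<in> L \<and> v \<in> L \<and> (\<forall>n. (u n, v n) \<in> rel_le (P n) \<or> (v n, u n) \<in> rel_le (P n))"
  show "(u, v) \<in> LE \<union> LE\<inverse>"
  proof (cases "(u, v) \<in> LE")
    case False
    then obtain n where n: "(u n, v n) \<notin> rel_le (P n)" using * by (auto simp: limit_le_iff)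
    have "(v m, u m) \<in> rel_le (P m)" for m
    proof -
      have "(u (max n m), v (max n m)) \<notin> rel_le (P (max n m))"
        using n level_le[of u v n "max n m"] * by auto
      then have "(v (max n m), u (max n m)) \<in> rel_le (P (max n m))" using * by blast
      then show ?thesis using level_le[of v u m "max n m"] * by auto
    qed
    then show ?thesis using * by (simp add: limit_le_iff)
  qed simp
qed

lemma equiv_comparable: "equiv L (LE \<union> LE\<inverse>)"
proof (rule equivI)
  show "LE \<union> LE\<inverse> \<subseteq> L \<times> L" by (auto simp: limit_le_iff)
  show "refl_on L (LE \<union> LE\<inverse>)" unfolding refl_on_def using limit_le_refl by simp
  show "sym (LE \<union> LE\<inverse>)" unfolding sym_def by simp
  show "trans (LE \<union> LE\<inverse>)"
  proof (rule transI)
    fix u v w assume "(u, v) \<in> LE \<union> LE\<inverse>" "(v, w) \<in> LE \<union> LE\<inverse>"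
    then show "(u, w) \<in> LE \<union> LE\<inverse>"
      unfolding limit_comparable_iff
      using family_F0_comparable_trans[OF F0, of "u n" "v n" n "w n" for n] by simp
  qed
qed

lemma limit_R_comparable: "(u, v) \<in> RR \<Longrightarrow> (u, v) \<in> LE \<union> LE\<inverse>"
  unfolding limit_comparable_iff limit_R_iff by (simp add: family_F0_R_comparable[OF F0])

text \<open>A point different from both ends is already different from both at one common level,
  where it would lie strictly inside an adjacent pair. So \<open>RR\<close>-classes are order
  convex.\<close>

lemma limit_R_between:
  assumes "(u, w) \<in> RR" "(u, v) \<in> LE" "(v, w) \<in> LE"
  shows "v = u \<or> v = w"
proof (rule ccontr)
  assume "\<not> ?thesis"
  then obtain m n where mn: "v m \<noteq> u m" "v n \<noteq> w n" by (auto simp: fun_eq_iff)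
  have "v (max m n) \<noteq> u (max m n)" "v (max m n) \<noteq> w (max m n)"
    using mn level_eq[of v u m "max m n"] level_eq[of v w n "max m n"] limit_leD(1,2)[OF assms(2)] limit_leD(2)[OF assms(3)] by auto
  then show False
    using family_F0_R_between[OF F0, of "u (max m n)" "w (max m n)" "max m n" "v (max m n)"] assms
    by (simp add: limit_R_iff limit_le_iff)
qed

section \<open>Construction of threads with prescribed coordinates\<close>

text \<open>If every element of \<open>Q k\<close> has a preimage in \<open>Q (Suc k)\<close>, a
  thread can be chosen upwards one level at a time. It is applied to whole carriers and to order
  intervals.\<close>

lemma limit_lift:
  assumes a: "a \<in> Q m" and Q: "\<And>k. m \<le> k \<Longrightarrow> Q k \<subseteq> univ (P k)"
    and ext: "\<And>k c. m \<le> k \<Longrightarrow> c \<in> Q k \<Longrightarrow> \<exists>c'\<in>Q (Suc k). \<phi> k (Suc k) c' = c"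
  shows "\<exists>u\<in>L. u m = a \<and> (\<forall>k\<ge>m. u k \<in> Q k)"
proof -
  \<comment> \<open>The index is shifted by \<open>m\<close>, and the clause for
    \<open>k = 0\<close> pins the starting value.\<close>
  have "\<exists>s. \<forall>k. (s k \<in> Q (m + k) \<and> (k = 0 \<longrightarrow> s k = a)) \<and> \<phi> (m + k) (Suc (m + k)) (s (Suc k)) = s k"
  proof (rule dependent_nat_choice)
    show "\<exists>x. x \<in> Q (m + 0) \<and> (0 = 0 \<longrightarrow> x = a)" using a by simp
    show "\<exists>y. (y \<in> Q (m + Suc k) \<and> (Suc k = 0 \<longrightarrow> y = a)) \<and> \<phi> (m + k) (Suc (m + k)) y = x"
      if "x \<in> Q (m + k) \<and> (k = 0 \<longrightarrow> x = a)" for x k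
      using ext[of "m + k" x] that by auto
  qed
  then obtain s where
    "\<forall>k. (s k \<in> Q (m + k) \<and> (k = 0 \<longrightarrow> s k = a)) \<and> \<phi> (m + k) (Suc (m + k)) (s (Suc k)) = s k" ..
  then have s: "s k \<in> Q (m + k)" "s 0 = a" "\<phi> (m + k) (Suc (m + k)) (s (Suc k)) = s k" for k
    by simp_all
  \<comment> \<open>Below level \<open>m\<close> the coordinates are forced: they are the images of
    \<open>a\<close>.\<close>
  define u where "u j = (if j < m then \<phi> j m a else s (j - m))" for j
  have am: "a \<in> univ (P m)" using a Q by blast
  have uQ: "u k \<in> Q k" if "m \<le> k" for k
    using s(1)[of "k - m"] that by (simp add: u_def)
  have "u \<in> L"
  proof (rule limitI)
    show "u n \<in> univ (P n)" for n
    proof (cases "n < m")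
      case True
      then show ?thesis using bond_in[of n m a] am by (simp add: u_def)
    next
      case False
      then show ?thesis using uQ[of n] Q[of n] by auto
    qed
    show "\<phi> n (Suc n) (u (Suc n)) = u n" for n
    proof -
      consider "Suc n < m" | "Suc n = m" | "m \<le> n" by linarith
      then show ?thesis
      proof cases
        case 1
        then show ?thesis using bond_comp[of n m a] am by (simp add: u_def)
      next
        case 2
        then show ?thesis using s(2) by (auto simp: u_def)
      next
        case 3
        then show ?thesis using s(3)[of "n - m"] by (simp add: u_def Suc_diff_le)
      qed
    qed
  qed
  moreover have "u m = a" using s(2) by (simp add: u_def)
  ultimately show ?thesis using uQ by blast
qed

lemma limit_nonempty: "L \<noteq> {}"
proof -
  obtain a where a: "a \<in> univ (P 0)" using family_F0_carrier(2)[OF F0] by blast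
  have "\<exists>u\<in>L. u 0 = a \<and> (\<forall>k\<ge>0. u k \<in> univ (P k))"
  proof (rule limit_lift)
    show "\<exists>c'\<in>univ (P (Suc k)). \<phi> k (Suc k) c' = c" if "c \<in> univ (P k)" for k c
      using that unfolding bond_image[of k, symmetric] by blast
  qed (use a in simp_all)
  then show ?thesis by blast
qed

text \<open>By the discrete intermediate value theorem, the intervals between the coordinates of
  \<open>x\<close> and \<open>y\<close> satisfy the lifting condition. The resulting thread is
  controlled from level \<open>m\<close> on, and the inequalities descend to the earlier
  levels.\<close>

lemma limit_intermediate:
  assumes xy: "(x, y) \<in> LE" and c: "(x m, c) \<in> rel_le (P m)" "(c, y m) \<in> rel_le (P m)"
  obtains z where "(x, z) \<in> LE" "(z, y) \<in> LE" "z m = c"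
proof -
  define Q where "Q k = {c. (x k, c) \<in> rel_le (P k) \<and> (c, y k) \<in> rel_le (P k)}" for k
  have L: "x \<in> L" "y \<in> L" using limit_leD[OF xy] by simp_all
  have 1: "Q k \<subseteq> univ (P k)" for k
    using family_F0_carrier(3)[OF F0] unfolding Q_def by blast
  have 2: "\<exists>c'\<in>Q (Suc k). \<phi> k (Suc k) c' = c" if c: "c \<in> Q k" for k c
  proof -
    have "(x (Suc k), y (Suc k)) \<in> rel_le (P (Suc k))" by (rule limit_leD(3)[OF xy])
    then obtain z where "(x (Suc k), z) \<in> rel_le (P (Suc k))" "(z, y (Suc k)) \<in> rel_le (P (Suc k))"
      "\<phi> k (Suc k) z = c"
      by (rule epimorphism_intermediate[OF F0 F0 epi[of k], of "x (Suc k)" "y (Suc k)" c])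
        (use c limit_step[OF L(1), of k] limit_step[OF L(2), of k] in \<open>simp_all add: Q_def\<close>)
    then show ?thesis unfolding Q_def by blast
  qed
  have "c \<in> Q m" using c unfolding Q_def by blast
  then have "\<exists>z\<in>L. z m = c \<and> (\<forall>k\<ge>m. z k \<in> Q k)"
    by (rule limit_lift) (simp_all add: 1 2)
  then obtain z where z: "z \<in> L" "z m = c" "\<forall>k\<ge>m. z k \<in> Q k" by blast
  have "(x n, z n) \<in> rel_le (P n) \<and> (z n, y n) \<in> rel_le (P n)" for n
    using z(3)[rule_format, of "max m n"] level_le[OF L(1) z(1), of n "max m n"] level_le[OF z(1) L(2), of n "max m n"]
    unfolding Q_def by auto
  then have "(x, z) \<in> LE" "(z, y) \<in> LE" using z(1) L by (simp_all add: limit_le_iff)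
  then show thesis using z(2) by (rule that)
qed

section \<open>Monotone invariant functions\<close>

lemma continuous_map_coordinate: "continuous_map T (discrete_topology (univ (P n))) (\<lambda>u. u n)"
  unfolding limit_topology_def
  by (intro continuous_map_from_subtopology continuous_map_product_projection) simp

lemma limit_topspace: "topspace T = L"
  by (rule topspace_limit_topology)

lemma clopen_cylinder: "closedin T {u \<in> L. Q (u n)}" "openin T {u \<in> L. Q (u n)}"
proof -
  have *: "{u \<in> L. Q (u n)} = {u \<in> topspace T. u n \<in> {a \<in> univ (P n). Q a}}"
    using limit_in by (auto simp: limit_topspace)
  show "closedin T {u \<in> L. Q (u n)}" unfolding *
    by (rule closedin_continuous_map_preimage[OF continuous_map_coordinate]) auto
  show "openin T {u \<in> L. Q (u n)}" unfolding *
    by (rule openin_continuous_map_preimage[OF continuous_map_coordinate]) auto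
qed

text \<open>The thread conditions are equalities of continuous maps into discrete spaces, so they
  cut out a closed subset of a product of finite spaces.\<close>

lemma compact_limit: "compact_space T"
proof -
  let ?X = "product_topology (\<lambda>n. discrete_topology (univ (P n))) UNIV"
  have cX: "compact_space ?X"
    by (simp add: compact_space_product_topology compact_space_discrete_topology family_F0_carrier(1)[OF F0])
  have proj: "continuous_map ?X (discrete_topology (univ (P n))) (\<lambda>u. u n)" for n
    by (intro continuous_map_product_projection) simp
  have "closedin ?X {u \<in> topspace ?X. u n = (\<phi> n (Suc n) \<circ> (\<lambda>u. u (Suc n))) u}" for n
  proof (rule closedin_continuous_maps_eq[OF _ proj])
    have "continuous_map (discrete_topology (univ (P (Suc n)))) (discrete_topology (univ (P n))) (\<phi> n (Suc n))"
      using epi[of n] unfolding epimorphism_def by simp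
    then show "continuous_map ?X (discrete_topology (univ (P n))) (\<phi> n (Suc n) \<circ> (\<lambda>u. u (Suc n)))"
      by (rule continuous_map_compose[OF proj])
  qed simp
  then have "closedin ?X (\<Inter>n. {u \<in> topspace ?X. u n = (\<phi> n (Suc n) \<circ> (\<lambda>u. u (Suc n))) u})"
    by (intro closedin_Inter) auto
  also have "(\<Inter>n. {u \<in> topspace ?X. u n = (\<phi> n (Suc n) \<circ> (\<lambda>u. u (Suc n))) u}) = L"
    unfolding proj_limit_def topspace_product_topology topspace_discrete_topology o_def by blast
  finally have "closedin ?X L" .
  then show ?thesis
    unfolding limit_topology_def by (intro compact_space_subtopology closedin_compact_space[OF cX])
qed

lemma closedin_level_relation:
  "closedin (prod_topology T T) {(u, v) \<in> L \<times> L. (u n, v n) \<in> r}"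
proof -
  let ?D = "discrete_topology (univ (P n))"
  have "continuous_map (prod_topology T T) (prod_topology ?D ?D) (\<lambda>z. (fst z n, snd z n))"
  proof (intro continuous_map_pairedI)
    show "continuous_map (prod_topology T T) ?D (\<lambda>z. fst z n)"
      using continuous_map_compose[OF continuous_map_fst continuous_map_coordinate] by (simp add: o_def)
    show "continuous_map (prod_topology T T) ?D (\<lambda>z. snd z n)"
      using continuous_map_compose[OF continuous_map_snd continuous_map_coordinate] by (simp add: o_def)
  qed
  moreover have "prod_topology ?D ?D = discrete_topology (univ (P n) \<times> univ (P n))"
    by (rule prod_topology_discrete_topology[symmetric])
  ultimately have "closedin (prod_topology T T) {z \<in> topspace (prod_topology T T).
      (fst z n, snd z n) \<in> r \<inter> univ (P n) \<times> univ (P n)}"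
    by (intro closedin_continuous_map_preimage) auto
  also have "\<dots> = {(u, v) \<in> L \<times> L. (u n, v n) \<in> r}"
    using limit_in by (auto simp: limit_topspace)
  finally show ?thesis .
qed

text \<open>The pairs from \<open>K\<close> and \<open>K'\<close> that are adjacent at level
  \<open>n\<close> form a decreasing sequence of closed sets. If none were empty, compactness would
  give a common pair, which is \<open>RR\<close>-related.\<close>

lemma R_separated_level:
  assumes K: "closedin T K" "closedin T K'" and disj: "\<And>u v. u \<in> K \<Longrightarrow> v \<in> K' \<Longrightarrow> (u, v) \<notin> RR"
  shows "\<exists>m. \<forall>k\<ge>m. \<forall>u\<in>K. \<forall>v\<in>K'. (u k, v k) \<notin> rel_R (P k)"
proof -
  have sub: "K \<subseteq> L" "K' \<subseteq> L" using K closedin_subset limit_topspace by metis+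
  define C where "C n = (K \<times> K') \<inter> {(u, v) \<in> L \<times> L. (u n, v n) \<in> rel_R (P n)}" for n
  have "\<exists>n. C n = {}"
  proof (rule ccontr)
    assume ne: "\<nexists>n. C n = {}"
    have "(\<Inter>n. C n) \<noteq> {}"
    proof (rule compact_space_imp_nest)
      show "compact_space (prod_topology T T)" using compact_limit by (simp add: compact_space_prod_topology)
      show "closedin (prod_topology T T) (C n)" for n
        unfolding C_def using K closedin_level_relation by (intro closedin_Int) (simp_all add: closedin_prod_Times_iff)
      show "C n \<noteq> {}" for n using ne by blast
      show "decseq C"
      proof (rule decseq_SucI)
        fix n
        show "C (Suc n) \<subseteq> C n"
          using level_R[of _ _ n "Suc n"] unfolding C_def by auto
      qed
    qed
    then obtain u v where uv: "(u, v) \<in> (\<Inter>n. C n)" by auto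
    then have "(u, v) \<in> RR" "u \<in> K" "v \<in> K'" unfolding C_def limit_R_iff by auto
    then show False using disj by blast
  qed
  then obtain m where m: "C m = {}" by blast
  show ?thesis
  proof (intro exI[of _ m] allI impI ballI)
    fix k u v assume k: "m \<le> k" "u \<in> K" "v \<in> K'"
    then have "u \<in> L" "v \<in> L" using sub by auto
    moreover have "(u m, v m) \<notin> rel_R (P m)" using m k calculation unfolding C_def by auto
    ultimately show "(u k, v k) \<notin> rel_R (P k)" using level_R k(1) by blast
  qed
qed

lemma closedin_R_saturation:
  assumes K: "closedin T K"
  shows "closedin T (RR `` K)"
proof -
  have "\<exists>U. openin T U \<and> w \<in> U \<and> U \<subseteq> L - RR `` K" if w: "w \<in> L - RR `` K" for w
  proof -
    \<comment> \<open>The basic neighbourhoods of \<open>w\<close>; once level \<open>m\<close>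
      separates \<open>K\<close> from \<open>w\<close>, the one of level \<open>m\<close> avoids the
      saturation, because membership in it depends only on the coordinate \<open>m\<close>.\<close>
    let ?U = "\<lambda>m. {w' \<in> L. w' m = w m}"
    have "closedin T (\<Inter>m. ?U m)" using clopen_cylinder(1) by (intro closedin_Inter) auto
    moreover have "(\<Inter>m. ?U m) = {w}" using w by auto
    ultimately have cw: "closedin T {w}" by simp
    have "(u, v) \<notin> RR" if "u \<in> K" "v \<in> {w}" for u v using that w by blast
    from R_separated_level[OF K cw this]
    obtain m where m: "\<forall>k\<ge>m. \<forall>u\<in>K. \<forall>v\<in>{w}. (u k, v k) \<notin> rel_R (P k)" ..
    have "w' \<notin> RR `` K" if "w' \<in> ?U m" for w'
    proof
      assume "w' \<in> RR `` K"
      then obtain u where u: "u \<in> K" "(u, w') \<in> RR" by blast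
      show False using m[rule_format, of m u w] u(1) limit_RD(3)[OF u(2), of m] that by simp
    qed
    then have "?U m \<subseteq> L - RR `` K" by blast
    moreover have "openin T (?U m)" by (rule clopen_cylinder(2))
    moreover have "w \<in> ?U m" using w by simp
    ultimately show ?thesis by blast
  qed
  then have "openin T (L - RR `` K)" by (subst openin_subopen) blast
  moreover have "RR `` K \<subseteq> L" using limit_RD(2) by blast
  ultimately show ?thesis unfolding closedin_def limit_topspace by simp
qed

section \<open>Level downsets and Urysohn interpolation\<close>

text \<open>Being a downset at one finite level is more than being a downset for \<open>LE\<close>:
  the set is then determined by a single coordinate and therefore clopen.\<close>

definition level_downset :: "(nat \<Rightarrow> 'a) set \<Rightarrow> bool" where
  "level_downset A \<longleftrightarrow>
     A \<subseteq> L \<and> (\<exists>n. \<forall>u\<in>A. \<forall>v\<in>L. (v n, u n) \<in> rel_le (P n) \<longrightarrow> v \<in> A)"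

text \<open>Plays the part of "the closure of \<open>A\<close> lies in the interior of
  \<open>B\<close>" in the classical Urysohn construction, with \<open>RR\<close>-saturation in
  place of closure.\<close>

definition strongly_below :: "(nat \<Rightarrow> 'a) set \<Rightarrow> (nat \<Rightarrow> 'a) set \<Rightarrow> bool" where
  "strongly_below A B \<longleftrightarrow> level_downset A \<and> level_downset B \<and> RR `` A \<subseteq> B"

lemma level_downset_clopen:
  assumes "level_downset A"
  shows "closedin T A" "openin T A"
proof -
  obtain n where n: "A \<subseteq> L" "\<forall>u\<in>A. \<forall>v\<in>L. (v n, u n) \<in> rel_le (P n) \<longrightarrow> v \<in> A"
    using assms unfolding level_downset_def by blast
  have "v \<in> A" if "u \<in> A" "v \<in> L" "v n = u n" for u v
    using n that family_F0_refl[OF F0 limit_in[OF that(2)], of n] by auto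
  then have "A = {v \<in> L. v n \<in> (\<lambda>u. u n) ` A}" using n(1) by auto
  then show "closedin T A" "openin T A"
    using clopen_cylinder[of "\<lambda>a. a \<in> (\<lambda>u. u n) ` A" n] by simp_all
qed

lemma level_downset_down:
  assumes "level_downset A" "v \<in> A" "(u, v) \<in> LE"
  shows "u \<in> A"
proof -
  obtain n where "\<forall>u\<in>A. \<forall>v\<in>L. (v n, u n) \<in> rel_le (P n) \<longrightarrow> v \<in> A"
    using assms(1) unfolding level_downset_def by blast
  then show ?thesis using assms(2) limit_leD(1)[OF assms(3)] limit_leD(3)[OF assms(3), of n] by blast
qed

lemma strongly_below_subset: "strongly_below A B \<Longrightarrow> A \<subseteq> B"
  unfolding strongly_below_def level_downset_def using limit_R_refl by blast

lemma strongly_below_trans: "strongly_below A B \<Longrightarrow> strongly_below B C \<Longrightarrow> strongly_below A C"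
  using strongly_below_subset[of B C] unfolding strongly_below_def by blast

text \<open>Transitivity of the limit relation is what makes interpolation possible: closed sets which
  are not linked by it are already unlinked at some finite level.\<close>

lemma strongly_below_interpolate:
  assumes AB: "strongly_below A B"
  shows "\<exists>C. strongly_below A C \<and> strongly_below C B"
proof -
  have A: "level_downset A" and B: "level_downset B" and sub: "RR `` A \<subseteq> B"
    using AB unfolding strongly_below_def by auto
  obtain n where n: "A \<subseteq> L" "\<forall>u\<in>A. \<forall>v\<in>L. (v n, u n) \<in> rel_le (P n) \<longrightarrow> v \<in> A"
    using A unfolding level_downset_def by blast
  have "closedin T (L - B)"
    using level_downset_clopen(2)[OF B] closedin_diff[OF closedin_topspace, of T B] limit_topspace by simp
  then have cl: "closedin T (RR `` (L - B))" by (rule closedin_R_saturation)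
  \<comment> \<open>A link would compose with the one from \<open>w\<close> to a point outside
    \<open>B\<close>, putting that point into the saturation of \<open>A\<close>.\<close>
  have "(a, w) \<notin> RR" if "a \<in> A" "w \<in> RR `` (L - B)" for a w
    using that sub limit_R_trans limit_R_sym by blast
  from R_separated_level[OF level_downset_clopen(1)[OF A] cl this]
  obtain m where m: "\<forall>k\<ge>m. \<forall>u\<in>A. \<forall>v\<in>RR `` (L - B). (u k, v k) \<notin> rel_R (P k)" ..
  define k where "k = max m n"
  \<comment> \<open>The interpolant consists of the threads adjacent to \<open>A\<close> at level
    \<open>k\<close>. The bound \<open>k \<ge> m\<close> keeps it off the saturation of the
    complement of \<open>B\<close>; the bound \<open>k \<ge> n\<close> makes \<open>A\<close> a
    downset at level \<open>k\<close>, which is used to show that \<open>C\<close> is one.\<close>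
  define C where "C = {w \<in> L. \<exists>a\<in>A. (a k, w k) \<in> rel_R (P k)}"
  have "level_downset C"
    unfolding level_downset_def
  proof (intro conjI exI[of _ k] ballI impI)
    show "C \<subseteq> L" unfolding C_def by blast
    fix u v assume u: "u \<in> C" and v: "v \<in> L" and vu: "(v k, u k) \<in> rel_le (P k)"
    obtain a where a: "a \<in> A" "(a k, u k) \<in> rel_R (P k)"
      using u unfolding C_def by blast
    have aL: "a \<in> L" using a n(1) by blast
    have "(v k, a k) \<in> rel_le (P k) \<or> (a k, v k) \<in> rel_le (P k)"
      using family_F0_comparable_trans[OF F0, of "v k" "u k" k "a k"] vu family_F0_R_comparable[OF F0 a(2)] by blast
    then show "v \<in> C"
    proof
      assume "(v k, a k) \<in> rel_le (P k)"
      then have "(v n, a n) \<in> rel_le (P n)" using level_le[OF v aL, of n k] unfolding k_def by simp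
      then have "v \<in> A" using n(2) a(1) v by blast
      then show ?thesis using v family_F0_R_refl[OF F0 limit_in[OF v]] unfolding C_def by blast
    next
      \<comment> \<open>Here \<open>v k\<close> is caught between the adjacent elements
        \<open>a k\<close> and \<open>u k\<close>, so it is one of them.\<close>
      assume "(a k, v k) \<in> rel_le (P k)"
      then have "v k = a k \<or> v k = u k" using family_F0_R_between[OF F0 a(2) _ vu] by blast
      then have "(a k, v k) \<in> rel_R (P k)" using a(2) family_F0_R_refl[OF F0 limit_in[OF v], of k] by auto
      then show ?thesis using v a(1) unfolding C_def by blast
    qed
  qed
  moreover have "RR `` A \<subseteq> C"
    unfolding C_def using limit_RD by blast
  moreover have "RR `` C \<subseteq> B"
  proof
    fix w' assume "w' \<in> RR `` C"
    then obtain w a where w: "(w, w') \<in> RR" "a \<in> A" "(a k, w k) \<in> rel_R (P k)" unfolding C_def by blast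
    show "w' \<in> B"
    proof (rule ccontr)
      assume "w' \<notin> B"
      then have "w \<in> RR `` (L - B)" using w(1) limit_R_sym limit_RD(2)[OF w(1)] by blast
      then show False using m[rule_format, of k a w] w unfolding k_def by simp
    qed
  qed
  ultimately show ?thesis using A B unfolding strongly_below_def by blast
qed

definition monotone_invariant :: "((nat \<Rightarrow> 'a) \<Rightarrow> real) \<Rightarrow> bool" where
  "monotone_invariant f \<longleftrightarrow> continuous_map T euclideanreal f \<and> (\<forall>u. f u \<in> {0..1}) \<and>
     (\<forall>u v. (u, v) \<in> LE \<longrightarrow> f u \<le> f v) \<and> (\<forall>u v. (u, v) \<in> RR \<longrightarrow> f u = f v)"

text \<open>Interpolation yields a dyadic family between \<open>A\<close> and \<open>B\<close>. Its
  members are downsets, which makes the Urysohn function monotone, and each contains the saturation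
  of all earlier ones, which makes it invariant.\<close>

lemma strongly_below_function:
  assumes AB: "strongly_below A B"
  shows "\<exists>f. monotone_invariant f \<and> (\<forall>u\<in>A. f u = 0) \<and> (\<forall>u\<in>L - B. f u = 1)"
proof -
  have "\<exists>G. G 0 = A \<and> G 1 = B \<and>
    (\<forall>x\<in>dyadics \<inter> {0..1::real}. \<forall>y\<in>dyadics \<inter> {0..1}. x < y \<longrightarrow> strongly_below (G x) (G y))"
    by (rule recursion_on_dyadic_fractions[where R = strongly_below, OF AB])
      (use strongly_below_interpolate strongly_below_trans in blast)+
  then obtain G where G01: "G 0 = A" "G 1 = B"
    and G: "\<forall>x\<in>dyadics \<inter> {0..1::real}. \<forall>y\<in>dyadics \<inter> {0..1}. x < y \<longrightarrow> strongly_below (G x) (G y)"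
    by blast
  have 0: "0 \<in> dyadics \<inter> {0..1::real}" and 1: "1 \<in> dyadics \<inter> {0..1::real}"
    by (force simp: dyadics_def)+
  \<comment> \<open>The recursion only provides the relation between different indices, so for
    \<open>r < 1\<close> the property is read off from comparison with index 1, and index 1 is
    \<open>B\<close> itself.\<close>
  have down: "level_downset (G r)" if r: "r \<in> dyadics \<inter> {0..1}" for r
  proof (cases "r = 1")
    case True
    then show ?thesis using AB G01 unfolding strongly_below_def by simp
  next
    case False
    then have "r < 1" using r by simp
    then show ?thesis using G r 1 unfolding strongly_below_def by blast
  qed
  have "\<exists>f. continuous_map T euclideanreal f \<and> (\<forall>x. f x \<in> {0..1}) \<and>
    (\<forall>r\<in>dyadics \<inter> {0..1}. \<forall>x. (x \<in> G r \<longrightarrow> f x \<le> r) \<and> (x \<notin> G r \<longrightarrow> r \<le> f x))"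
  proof (rule dyadic_clopen_family_function)
    show "closedin T (G r) \<and> openin T (G r)" if "r \<in> dyadics \<inter> {0..1}" for r
      using level_downset_clopen[OF down[OF that]] by simp
    show "G r \<subseteq> G s" if "r \<in> dyadics \<inter> {0..1}" "s \<in> dyadics \<inter> {0..1}" "r < s" for r s
      using G that strongly_below_subset by blast
  qed
  then obtain f where f0: "continuous_map T euclideanreal f \<and> (\<forall>x. f x \<in> {0..1}) \<and>
    (\<forall>r\<in>dyadics \<inter> {0..1}. \<forall>x. (x \<in> G r \<longrightarrow> f x \<le> r) \<and> (x \<notin> G r \<longrightarrow> r \<le> f x))" ..
  have f: "continuous_map T euclideanreal f" "f u \<in> {0..1}" for u
    using f0 by blast+
  have le: "f u \<le> r" if "r \<in> dyadics \<inter> {0..1}" "u \<in> G r" for r u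
    using f0 that by blast
  have ge: "r \<le> f u" if "r \<in> dyadics \<inter> {0..1}" "u \<notin> G r" for r u
    using f0 that by blast
  \<comment> \<open>Comparison criterion: if \<open>f v < f u\<close>, two dyadics
    \<open>r < s\<close> fit in between, with \<open>v\<close> in \<open>G r\<close> and
    \<open>u\<close> not in \<open>G s\<close>. The gap between \<open>r\<close> and
    \<open>s\<close> leaves room for one passage to the \<open>RR\<close>-saturation.\<close>
  have key: "f u \<le> f v" if uv: "\<And>r s. r \<in> dyadics \<inter> {0..1} \<Longrightarrow> s \<in> dyadics \<inter> {0..1} \<Longrightarrow> r < s
      \<Longrightarrow> v \<in> G r \<Longrightarrow> u \<in> G s" for u v
  proof (rule ccontr)
    assume "\<not> f u \<le> f v"
    then have lt: "f v < f u" by simp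
    obtain r where r: "r \<in> dyadics \<inter> {0..1}" "f v < r" "r < f u"
      by (rule dyadics_dense_unit_interval[of "f v" "f u"]) (use f(2)[of u] f(2)[of v] lt in auto)
    obtain s where s: "s \<in> dyadics \<inter> {0..1}" "r < s" "s < f u"
      by (rule dyadics_dense_unit_interval[of r "f u"]) (use f(2)[of u] r in auto)
    have "v \<in> G r" using ge[of r v] r by force
    moreover have "u \<notin> G s" using le[of s u] s by force
    ultimately show False using uv[OF r(1) s(1) s(2)] by blast
  qed
  have mono: "f u \<le> f v" if "(u, v) \<in> LE" for u v
  proof (rule key)
    fix r s :: real assume r: "r \<in> dyadics \<inter> {0..1}" "s \<in> dyadics \<inter> {0..1}" "r < s" "v \<in> G r"
    then have "u \<in> G r" using level_downset_down[OF down[OF r(1)] _ that] by blast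
    then show "u \<in> G s" using G r strongly_below_subset by blast
  qed
  have inv: "f u \<le> f v" if "(v, u) \<in> RR" for u v
  proof (rule key)
    fix r s :: real assume r: "r \<in> dyadics \<inter> {0..1}" "s \<in> dyadics \<inter> {0..1}" "r < s" "v \<in> G r"
    then show "u \<in> G s" using G that unfolding strongly_below_def by blast
  qed
  have inv': "f u = f v" if "(u, v) \<in> RR" for u v
    using inv[OF that] inv[OF limit_R_sym[OF that]] by simp
  have "f u = 0" if "u \<in> A" for u
    using le[OF 0, of u] that f(2)[of u] G01 by simp
  moreover have "f u = 1" if "u \<in> L - B" for u
    using ge[OF 1, of u] that f(2)[of u] G01 by simp
  moreover have "monotone_invariant f"
    unfolding monotone_invariant_def using f mono inv' by blast
  ultimately show ?thesis by blast
qed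

section \<open>Countably many functions separating the classes\<close>

text \<open>Compare the downset of \<open>a\<close> with the complement of the upset of
  \<open>b\<close>. An \<open>RR\<close>-link from the downset into that upset would be an adjacent
  pair at level \<open>n\<close> with \<open>a\<close> and \<open>b\<close> between its ends; this
  forces \<open>a\<close> and \<open>b\<close> to be those ends, although they are not
  adjacent.\<close>

lemma level_separating_function:
  assumes ab: "a \<in> univ (P n)" "b \<in> univ (P n)" "(b, a) \<notin> rel_le (P n)" "(a, b) \<notin> rel_R (P n)"
  shows "\<exists>f. monotone_invariant f \<and> (\<forall>u\<in>L. (u n, a) \<in> rel_le (P n) \<longrightarrow> f u = 0) \<and>
    (\<forall>u\<in>L. (b, u n) \<in> rel_le (P n) \<longrightarrow> f u = 1)"
proof -
  let ?A = "{u \<in> L. (u n, a) \<in> rel_le (P n)}" and ?B = "{u \<in> L. (b, u n) \<notin> rel_le (P n)}"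
  note tr = family_F0_trans[OF F0]
  have "level_downset ?A"
    unfolding level_downset_def using tr by (intro conjI exI[of _ n]) blast+
  moreover have "level_downset ?B"
    unfolding level_downset_def using tr by (intro conjI exI[of _ n]) blast+
  moreover have "RR `` ?A \<subseteq> ?B"
  proof
    fix w' assume "w' \<in> RR `` ?A"
    then obtain w where w: "w \<in> L" "(w n, a) \<in> rel_le (P n)" "(w, w') \<in> RR" by blast
    have R: "(w n, w' n) \<in> rel_R (P n)" using limit_RD(3)[OF w(3)] .
    have "(b, w' n) \<notin> rel_le (P n)"
    proof
      assume b: "(b, w' n) \<in> rel_le (P n)"
      have "(w n, w' n) \<in> rel_le (P n) \<or> (w' n, w n) \<in> rel_le (P n)"
        by (rule family_F0_R_comparable[OF F0 R])
      then show False
      proof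
        assume "(w' n, w n) \<in> rel_le (P n)"
        then show False using tr[OF tr[OF b] w(2)] ab(3) by blast
      next
        assume ww: "(w n, w' n) \<in> rel_le (P n)"
        have "(a, w' n) \<in> rel_le (P n) \<or> (w' n, a) \<in> rel_le (P n)"
          using family_F0_comparable_trans[OF F0, of a "w n" n "w' n"] w(2) ww by blast
        moreover have "(w' n, a) \<notin> rel_le (P n)" using tr[OF b] ab(3) by blast
        ultimately have aw: "(a, w' n) \<in> rel_le (P n)" by blast
        have "(a, b) \<in> rel_le (P n)"
          using family_F0_comparable_trans[OF F0, of a "w' n" n b] aw b ab(3) by blast
        then have "(w n, b) \<in> rel_le (P n)" using tr[OF w(2)] by blast
        then have bb: "b = w n \<or> b = w' n" using family_F0_R_between[OF F0 R _ b] by blast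
        have aa: "a = w n \<or> a = w' n" using family_F0_R_between[OF F0 R w(2) aw] .
        have "b \<noteq> w n" using w(2) ab(3) by blast
        then have "b = w' n" using bb by blast
        moreover have "a \<noteq> w' n" using \<open>(w' n, a) \<notin> rel_le (P n)\<close> family_F0_refl[OF F0 ab(1)] by blast
        ultimately show False using aa R ab(4) by simp
      qed
    qed
    then show "w' \<in> ?B" using limit_RD(2)[OF w(3)] by simp
  qed
  ultimately have "strongly_below ?A ?B" unfolding strongly_below_def by blast
  then obtain f where "monotone_invariant f" "\<forall>u\<in>?A. f u = 0" "\<forall>u\<in>L - ?B. f u = 1"
    using strongly_below_function by blast
  then show ?thesis by (intro exI[of _ f]) auto
qed

lemma separating_sequence:
  "\<exists>F. (\<forall>k::nat. monotone_invariant (F k)) \<and>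
    (\<forall>u\<in>L. \<forall>v\<in>L. (u, v) \<notin> RR \<longrightarrow> (\<exists>k. F k u \<noteq> F k v))"
proof -
  define I where "I = {(n, a, b). a \<in> univ (P n) \<and> b \<in> univ (P n) \<and> (b, a) \<notin> rel_le (P n) \<and>
    (a, b) \<notin> rel_R (P n)}"
  have "I \<subseteq> (SIGMA n:UNIV. univ (P n) \<times> univ (P n))" unfolding I_def by auto
  moreover have "countable (SIGMA n:UNIV. univ (P n) \<times> univ (P n))"
    by (intro countable_SIGMA) (auto intro: countable_finite family_F0_carrier(1)[OF F0])
  ultimately have I: "countable I" using countable_subset by blast
  have "\<forall>i\<in>I. \<exists>f. monotone_invariant f \<and>
      (\<forall>u\<in>L. (u (fst i), fst (snd i)) \<in> rel_le (P (fst i)) \<longrightarrow> f u = 0) \<and>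
      (\<forall>u\<in>L. (snd (snd i), u (fst i)) \<in> rel_le (P (fst i)) \<longrightarrow> f u = 1)"
    using level_separating_function unfolding I_def by auto
  then obtain g where g: "\<forall>i\<in>I. monotone_invariant (g i) \<and>
      (\<forall>u\<in>L. (u (fst i), fst (snd i)) \<in> rel_le (P (fst i)) \<longrightarrow> g i u = 0) \<and>
      (\<forall>u\<in>L. (snd (snd i), u (fst i)) \<in> rel_le (P (fst i)) \<longrightarrow> g i u = 1)"
    by (rule bchoice[THEN exE])
  \<comment> \<open>The zero function guarantees that there is something to enumerate even if
    \<open>I\<close> is empty.\<close>
  define \<F> where "\<F> = insert (\<lambda>_. 0) (g ` I)"
  have \<F>: "countable \<F>" "\<F> \<noteq> {}" using I unfolding \<F>_def by auto
  have "monotone_invariant (\<lambda>_. 0)" unfolding monotone_invariant_def by simp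
  then have "monotone_invariant f" if "f \<in> \<F>" for f using g that unfolding \<F>_def by blast
  then have "monotone_invariant (from_nat_into \<F> k)" for k
    using from_nat_into[OF \<F>(2)] by blast
  moreover have "\<exists>k. from_nat_into \<F> k u \<noteq> from_nat_into \<F> k v"
    if uv: "u \<in> L" "v \<in> L" "(u, v) \<notin> RR" for u v
  proof -
    obtain n where n: "(u n, v n) \<notin> rel_R (P n)" using uv limit_R_iff by auto
    have un: "u n \<in> univ (P n)" "v n \<in> univ (P n)" using uv limit_in by auto
    have refl: "(u n, u n) \<in> rel_le (P n)" "(v n, v n) \<in> rel_le (P n)" using un family_F0_refl[OF F0] by auto
    have "\<exists>f\<in>\<F>. f u \<noteq> f v"
    proof (cases "(v n, u n) \<in> rel_le (P n)")
      case False
      \<comment> \<open>The separating lemma is oriented: the element in the role of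
        \<open>b\<close> must not lie below the one in the role of \<open>a\<close>. The two cases
        choose which thread supplies which.\<close>
      then have i: "(n, u n, v n) \<in> I" using un n unfolding I_def by blast
      have "g (n, u n, v n) u = 0" "g (n, u n, v n) v = 1" using bspec[OF g i] uv refl by auto
      then show ?thesis using i unfolding \<F>_def by force
    next
      case True
      have "u n \<noteq> v n" using n un family_F0_R_refl[OF F0] by metis
      then have "(u n, v n) \<notin> rel_le (P n)" using family_F0_antisym[OF F0 True] by auto
      then have i: "(n, v n, u n) \<in> I" using un n family_F0_R_sym[OF F0] unfolding I_def by blast
      have "g (n, v n, u n) v = 0" "g (n, v n, u n) u = 1" using bspec[OF g i] uv refl by auto
      then show ?thesis using i unfolding \<F>_def by force
    qed
    then obtain f where "f \<in> \<F>" "f u \<noteq> f v" by blast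
    then show ?thesis using from_nat_into_to_nat_on[OF \<F>(1)] by metis
  qed
  ultimately show ?thesis by (intro exI[of _ "from_nat_into \<F>"]) simp
qed

section \<open>The quotient\<close>

abbreviation p where "p \<equiv> limit_proj P \<phi>"
abbreviation X where "X \<equiv> limit_quotient P \<phi>"
abbreviation E where "E \<equiv> LE \<union> LE\<inverse>"

lemma proj_eq_iff: "u \<in> L \<Longrightarrow> v \<in> L \<Longrightarrow> p u = p v \<longleftrightarrow> (u, v) \<in> RR"
  unfolding limit_proj_def by (rule eq_equiv_class_iff[OF equiv_R])

lemma quotient_map_proj: "quotient_map T X p"
  unfolding limit_quotient_def by (rule quotient_map_quotient_topology)

lemma quotient_topspace: "topspace X = p ` L"
  unfolding limit_quotient_def topspace_quotient_topology limit_topspace ..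

lemma continuous_map_proj: "continuous_map T X p"
  by (rule quotient_imp_continuous_map[OF quotient_map_proj])

lemma compact_quotient: "compact_space X"
proof -
  have "compactin X (p ` L)"
    using image_compactin[OF _ continuous_map_proj, of L] compact_limit
    by (simp add: compact_space_def limit_topspace)
  then show ?thesis unfolding compact_space_def quotient_topspace .
qed

text \<open>Invariance lets the separating functions descend to the quotient, separation makes them
  jointly injective, and monotonicity is kept for the later use on chains.\<close>

lemma quotient_embedding:
  "\<exists>h :: (nat \<Rightarrow> 'a) set \<Rightarrow> nat \<Rightarrow> real. continuous_map X euclidean h \<and> inj_on h (topspace X) \<and>
    (\<forall>x k. h x k \<in> {0..1}) \<and> (\<forall>u v. (u, v) \<in> LE \<longrightarrow> h (p u) \<le> h (p v))"
proof -
  obtain F where F0: "(\<forall>k::nat. monotone_invariant (F k)) \<and>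
    (\<forall>u\<in>L. \<forall>v\<in>L. (u, v) \<notin> RR \<longrightarrow> (\<exists>k. F k u \<noteq> F k v))"
    using separating_sequence ..
  have F: "monotone_invariant (F k)" for k using F0 by simp
  \<comment> \<open>On the quotient the choice of representative is immaterial by invariance.
    Elsewhere the value is arbitrary but still in the unit interval, since \<open>F k\<close> takes
    all its values there.\<close>
  define h where "h x k = F k (SOME u. u \<in> L \<and> p u = x)" for x k
  have h: "h (p u) = (\<lambda>k. F k u)" if u: "u \<in> L" for u
  proof
    fix k
    define v where "v = (SOME v. v \<in> L \<and> p v = p u)"
    have "v \<in> L \<and> p v = p u" unfolding v_def by (rule someI[of _ u]) (simp add: u)
    then have "(v, u) \<in> RR" using proj_eq_iff u by blast
    then have "F k v = F k u" using F[of k] unfolding monotone_invariant_def by blast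
    then show "h (p u) k = F k u" unfolding h_def v_def by simp
  qed
  show ?thesis
  proof (intro exI[of _ h] conjI allI impI)
    have "continuous_map T (product_topology (\<lambda>k. euclideanreal) UNIV) (\<lambda>u k. F k u)"
      using F unfolding continuous_map_componentwise_UNIV monotone_invariant_def by simp
    then have "continuous_map T euclidean (\<lambda>u k. F k u)"
      by (simp only: euclidean_product_topology)
    then have "continuous_map T euclidean (h \<circ> p)"
      by (rule continuous_map_eq) (simp add: h limit_topspace)
    then show "continuous_map X euclidean h"
      by (rule continuous_compose_quotient_map[OF quotient_map_proj])
    show "inj_on h (topspace X)"
    proof (rule inj_onI)
      fix x y assume xy: "x \<in> topspace X" "y \<in> topspace X" and eq: "h x = h y"
      obtain u v where uv: "u \<in> L" "v \<in> L" "x = p u" "y = p v" using xy unfolding quotient_topspace by blast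
      have "F k u = F k v" for k using eq uv h[OF uv(1)] h[OF uv(2)] by (simp add: fun_eq_iff)
      then have "(u, v) \<in> RR" using F0 uv(1,2) by blast
      then show "x = y" using uv proj_eq_iff by simp
    qed
    show "h x k \<in> {0..1}" for x k
      using F[of k] unfolding h_def monotone_invariant_def by blast
    show "h (p u) \<le> h (p v)" if "(u, v) \<in> LE" for u v
    proof (rule le_funI)
      show "h (p u) k \<le> h (p v) k" for k
        using F[of k] that unfolding h[OF limit_leD(1)[OF that]] h[OF limit_leD(2)[OF that]]
          monotone_invariant_def by blast
    qed
  qed
qed

lemma metrizable_quotient: "metrizable_space X"
proof -
  obtain h :: "(nat \<Rightarrow> 'a) set \<Rightarrow> nat \<Rightarrow> real"
    where h: "continuous_map X euclidean h" "inj_on h (topspace X)" using quotient_embedding by blast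
  have "embedding_map X euclidean h"
    by (rule continuous_imp_embedding_map[OF h(1) compact_quotient _ h(2)]) simp
  then have "X homeomorphic_space top_of_set (h ` topspace X)"
    by (rule embedding_map_imp_homeomorphic_space)
  moreover have "metrizable_space (top_of_set (h ` topspace X))"
    by (intro metrizable_space_subtopology metrizable_space_euclidean)
  ultimately show ?thesis using homeomorphic_metrizable_space by blast
qed

section \<open>The order of the quotient and its maximal chains\<close>

lemma closedin_limit_le: "closedin (prod_topology T T) LE"
proof -
  have "LE = (\<Inter>n. {(u, v) \<in> L \<times> L. (u n, v n) \<in> rel_le (P n)})"
    unfolding limit_le_def by auto
  moreover have "closedin (prod_topology T T) (\<Inter>n. {(u, v) \<in> L \<times> L. (u n, v n) \<in> rel_le (P n)})"
    using closedin_level_relation by (intro closedin_Inter) auto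
  ultimately show ?thesis by simp
qed

text \<open>The relation is a continuous image of the compact set \<open>LE\<close>, and the target
  is Hausdorff.\<close>

lemma closedin_quotient_le: "closedin (prod_topology X X) (quotient_le P \<phi>)"
proof (rule compactin_imp_closedin)
  show "Hausdorff_space (prod_topology X X)"
    using metrizable_imp_Hausdorff_space[OF metrizable_quotient] by (simp add: Hausdorff_space_prod_topology)
  have "compact_space (prod_topology T T)" using compact_limit by (simp add: compact_space_prod_topology)
  then have "compactin (prod_topology T T) LE" using closedin_limit_le closedin_compact_space by blast
  moreover have "continuous_map (prod_topology T T) (prod_topology X X) (\<lambda>(x, y). (p x, p y))"
    using continuous_map_proj by (simp add: continuous_map_prod_top)
  ultimately have "compactin (prod_topology X X) ((\<lambda>(x, y). (p x, p y)) ` LE)"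
    by (rule image_compactin)
  moreover have "(\<lambda>(x, y). (p x, p y)) ` LE = quotient_le P \<phi>"
    unfolding quotient_le_def by (rule image_cong) auto
  ultimately show "compactin (prod_topology X X) (quotient_le P \<phi>)" by simp
qed

lemma comparable_trans: "(u, v) \<in> E \<Longrightarrow> (v, w) \<in> E \<Longrightarrow> (u, w) \<in> E"
  using equiv_comparable by (meson equivE transD)

lemma comparable_sym: "(u, v) \<in> E \<Longrightarrow> (v, u) \<in> E"
  by auto

text \<open>With its right-hand twin, shows that the order between different classes does not depend
  on representatives. Otherwise comparability gives \<open>v \<le> u'\<close>, and convexity of the
  class of \<open>u\<close> pulls \<open>v\<close> into it.\<close>

lemma limit_le_R_left:
  assumes uv: "(u, v) \<in> LE" "(u, v) \<notin> RR" and R: "(u, u') \<in> RR"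
  shows "(u', v) \<in> LE"
proof (rule ccontr)
  assume "(u', v) \<notin> LE"
  moreover have "(u', v) \<in> E"
    using comparable_trans[OF comparable_sym[OF limit_R_comparable[OF R]], of v] uv(1) by blast
  ultimately have "(v, u') \<in> LE" by blast
  then have "v = u \<or> v = u'" using limit_R_between[OF R uv(1)] by blast
  then show False using R uv(2) limit_R_refl[OF limit_RD(1)[OF R]] by blast
qed

lemma limit_le_R_right:
  assumes uv: "(u, v) \<in> LE" "(u, v) \<notin> RR" and R: "(v, v') \<in> RR"
  shows "(u, v') \<in> LE"
proof (rule ccontr)
  assume "(u, v') \<notin> LE"
  moreover have "(u, v') \<in> E"
    using comparable_trans[OF _ limit_R_comparable[OF R], of u] uv(1) by blast
  ultimately have "(v', u) \<in> LE" by blast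
  then have "u = v' \<or> u = v" using limit_R_between[OF limit_R_sym[OF R] _ uv(1)] by blast
  then show False using limit_R_sym[OF R] uv(2) limit_R_refl[OF limit_RD(1)[OF R]] by blast
qed

lemma quotient_le_iff:
  assumes uv: "u \<in> L" "v \<in> L"
  shows "(p u, p v) \<in> quotient_le P \<phi> \<longleftrightarrow> (u, v) \<in> RR \<or> (u, v) \<in> LE"
proof
  assume "(p u, p v) \<in> quotient_le P \<phi>"
  then obtain u' v' where uv': "(u', v') \<in> LE" "p u = p u'" "p v = p v'"
    unfolding quotient_le_def by auto
  have R: "(u', u) \<in> RR" "(v', v) \<in> RR"
    using uv' proj_eq_iff[OF limit_leD(1)[OF uv'(1)] uv(1)] proj_eq_iff[OF limit_leD(2)[OF uv'(1)] uv(2)] by simp_all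
  show "(u, v) \<in> RR \<or> (u, v) \<in> LE"
  proof (cases "(u, v) \<in> RR")
    case False
    \<comment> \<open>Both replacements need a pair that is not \<open>RR\<close>-related, so this
      is secured before each of them.\<close>
    have n1: "(u', v') \<notin> RR"
      using False limit_R_trans[OF limit_R_trans[OF limit_R_sym[OF R(1)]] R(2)] by blast
    have n2: "(u, v') \<notin> RR" using False limit_R_trans[OF _ R(2)] by blast
    show ?thesis using limit_le_R_right[OF limit_le_R_left[OF uv'(1) n1 R(1)] n2 R(2)] by blast
  qed simp
next
  assume "(u, v) \<in> RR \<or> (u, v) \<in> LE"
  then show "(p u, p v) \<in> quotient_le P \<phi>"
  proof
    assume "(u, v) \<in> RR"
    then have "p u = p v" using proj_eq_iff[OF uv] by simp
    moreover have "(p u, p u) \<in> quotient_le P \<phi>"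
      unfolding quotient_le_def using limit_le_refl[OF uv(1)] by force
    ultimately show ?thesis by simp
  next
    assume "(u, v) \<in> LE"
    then show ?thesis unfolding quotient_le_def by force
  qed
qed

lemma quotient_le_subset: "quotient_le P \<phi> \<subseteq> topspace X \<times> topspace X"
proof -
  have "LE \<subseteq> L \<times> L" using limit_leD(1,2) by auto
  then show ?thesis unfolding quotient_le_def quotient_topspace by auto
qed

lemma partial_order_quotient_le: "partial_order_on (topspace X) (quotient_le P \<phi>)"
  unfolding partial_order_on_def preorder_on_def
proof (intro conjI)
  let ?q = "quotient_le P \<phi>"
  have rep: "\<exists>u\<in>L. x = p u" if "x \<in> topspace X" for x using that unfolding quotient_topspace by blast
  show "?q \<subseteq> topspace X \<times> topspace X" by (rule quotient_le_subset)
  show "refl_on (topspace X) ?q"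
  proof (rule refl_onI)
    fix x assume "x \<in> topspace X"
    then obtain u where "u \<in> L" "x = p u" using rep by blast
    then show "(x, x) \<in> ?q" using quotient_le_iff limit_le_refl by simp
  qed
  show "trans ?q"
  proof (rule transI)
    fix x y z assume xyz: "(x, y) \<in> ?q" "(y, z) \<in> ?q"
    then have "x \<in> topspace X" "y \<in> topspace X" "z \<in> topspace X" using quotient_le_subset by auto
    then obtain u v w where r: "u \<in> L" "v \<in> L" "w \<in> L" "x = p u" "y = p v" "z = p w" using rep by meson
    have 1: "(u, v) \<in> RR \<or> (u, v) \<in> LE" using xyz(1) quotient_le_iff[OF r(1,2)] r by simp
    have 2: "(v, w) \<in> RR \<or> (v, w) \<in> LE" using xyz(2) quotient_le_iff[OF r(2,3)] r by simp
    have "(u, w) \<in> RR \<or> (u, w) \<in> LE"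
    proof (cases "(u, v) \<in> RR")
      case uv: True
      show ?thesis
      proof (cases "(v, w) \<in> RR")
        case True
        then show ?thesis using limit_R_trans[OF uv] by blast
      next
        case False
        then show ?thesis using 2 limit_le_R_left[OF _ False limit_R_sym[OF uv]] by blast
      qed
    next
      case uv: False
      then have le: "(u, v) \<in> LE" using 1 by blast
      then show ?thesis using 2 limit_le_R_right[OF le uv] limit_le_trans[OF le] by blast
    qed
    then show "(x, z) \<in> ?q" using quotient_le_iff[OF r(1,3)] r by simp
  qed
  show "antisym ?q"
  proof (rule antisymI)
    fix x y assume xy: "(x, y) \<in> ?q" "(y, x) \<in> ?q"
    then have "x \<in> topspace X" "y \<in> topspace X" using quotient_le_subset by auto
    then obtain u v where r: "u \<in> L" "v \<in> L" "x = p u" "y = p v" using rep by meson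
    have 1: "(u, v) \<in> RR \<or> (u, v) \<in> LE" using xy(1) quotient_le_iff[OF r(1,2)] r by simp
    have 2: "(v, u) \<in> RR \<or> (v, u) \<in> LE" using xy(2) quotient_le_iff[OF r(2,1)] r by simp
    have "(u, v) \<in> RR"
      using 1 2 limit_R_sym limit_le_antisym[of u v] limit_R_refl[OF r(1)] by blast
    then show "x = y" using proj_eq_iff[OF r(1,2)] r by simp
  qed
qed

lemma quotient_comparable_iff:
  assumes "u \<in> L" "v \<in> L"
  shows "(p u, p v) \<in> quotient_le P \<phi> \<union> (quotient_le P \<phi>)\<inverse> \<longleftrightarrow> (u, v) \<in> E"
  using quotient_le_iff[OF assms] quotient_le_iff[OF assms(2,1)] limit_R_comparable[of u v]
    limit_R_comparable[of v u] by auto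

lemma quotient_comparable_class:
  assumes u: "u \<in> L"
  shows "(quotient_le P \<phi> \<union> (quotient_le P \<phi>)\<inverse>) `` {p u} = p ` (E `` {u})"
proof (intro subset_antisym subsetI)
  fix y assume y: "y \<in> (quotient_le P \<phi> \<union> (quotient_le P \<phi>)\<inverse>) `` {p u}"
  then have "y \<in> topspace X" using quotient_le_subset by auto
  then obtain v where v: "v \<in> L" "y = p v" unfolding quotient_topspace by blast
  then have "(u, v) \<in> E" using y quotient_comparable_iff[OF u v(1)] by simp
  then show "y \<in> p ` (E `` {u})" using v(2) by blast
next
  fix y assume "y \<in> p ` (E `` {u})"
  then obtain v where v: "(u, v) \<in> E" "y = p v" by blast
  then have "v \<in> L" using limit_leD by blast
  then show "y \<in> (quotient_le P \<phi> \<union> (quotient_le P \<phi>)\<inverse>) `` {p u}"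
    using v quotient_comparable_iff[OF u, of v] by simp
qed

lemma maximal_chains_limit: "maximal_chains (limit_le P \<phi>) = {E `` {u} |u. u \<in> L}"
  unfolding maximal_chains_eq_quotient[OF equiv_comparable limit_nonempty] quotient_def by auto

lemma maximal_chains_quotient: "maximal_chains (quotient_le P \<phi>) = {p ` (E `` {u}) |u. u \<in> L}"
proof -
  let ?Q = "quotient_le P \<phi> \<union> (quotient_le P \<phi>)\<inverse>"
  have "equiv (topspace X) ?Q"
  proof (rule equivI)
    show "?Q \<subseteq> topspace X \<times> topspace X" using quotient_le_subset by auto
    show "refl_on (topspace X) ?Q"
      using partial_order_quotient_le unfolding partial_order_on_def preorder_on_def refl_on_def by simp
    show "sym ?Q" unfolding sym_def by simp
    show "trans ?Q"
    proof (rule transI)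
      fix x y z assume xyz: "(x, y) \<in> ?Q" "(y, z) \<in> ?Q"
      then have "x \<in> topspace X" "y \<in> topspace X" "z \<in> topspace X" using quotient_le_subset by auto
      then obtain u v w where r: "u \<in> L" "v \<in> L" "w \<in> L" "x = p u" "y = p v" "z = p w"
        unfolding quotient_topspace by auto
      show "(x, z) \<in> ?Q"
        using xyz comparable_trans[of u v w]
        unfolding r(4-6) quotient_comparable_iff[OF r(1,2)] quotient_comparable_iff[OF r(2,3)]
          quotient_comparable_iff[OF r(1,3)] by simp
    qed
  qed
  moreover have "topspace X \<noteq> {}" using limit_nonempty unfolding quotient_topspace by simp
  ultimately have "maximal_chains (quotient_le P \<phi>) = topspace X // ?Q" by (rule maximal_chains_eq_quotient)
  also have "\<dots> = (\<lambda>u. ?Q `` {p u}) ` L" unfolding quotient_def quotient_topspace by auto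
  also have "\<dots> = (\<lambda>u. p ` (E `` {u})) ` L" by (rule image_cong) (simp_all only: quotient_comparable_class)
  finally show ?thesis by auto
qed

section \<open>Connected components\<close>

text \<open>The core of connectedness. Without a link, no points of \<open>K\<close> and
  \<open>K'\<close> are adjacent at some level \<open>m\<close>. Among the points of
  \<open>K\<close> between \<open>x\<close> and \<open>y\<close> take \<open>z\<close> with
  \<open>z m\<close> maximal; the successor of \<open>z m\<close> towards \<open>y m\<close> is a
  coordinate of some \<open>w\<close> between \<open>z\<close> and \<open>y\<close>. Maximality puts
  \<open>w\<close> into \<open>K'\<close>, yet it is adjacent to \<open>z\<close> at level
  \<open>m\<close>.\<close>

lemma closed_cover_link:
  assumes K: "closedin T K" "closedin T K'" and xy: "x \<in> K" "y \<in> K'" "(x, y) \<in> LE"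
    and cover: "\<And>z. (x, z) \<in> LE \<Longrightarrow> (z, y) \<in> LE \<Longrightarrow> z \<in> K \<union> K'"
  shows "\<exists>u\<in>K. \<exists>v\<in>K'. (u, v) \<in> RR"
proof (rule ccontr)
  assume "\<not> ?thesis"
  then have "(u, v) \<notin> RR" if "u \<in> K" "v \<in> K'" for u v using that by blast
  from R_separated_level[OF K this]
  obtain m where m: "\<forall>k\<ge>m. \<forall>u\<in>K. \<forall>v\<in>K'. (u k, v k) \<notin> rel_R (P k)" ..
  have L: "x \<in> L" "y \<in> L" using limit_leD[OF xy(3)] by simp_all
  let ?S = "{z m |z. z \<in> K \<and> (x, z) \<in> LE \<and> (z, y) \<in> LE}"
  have "?S \<subseteq> univ (P m)" using limit_in limit_leD(1) by blast
  then have "finite ?S" using family_F0_carrier(1)[OF F0] finite_subset by blast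
  moreover have "x m \<in> ?S" using xy(1,3) limit_le_refl[OF L(1)] by blast
  ultimately obtain c where c: "c \<in> ?S" "\<forall>d\<in>?S. (c, d) \<in> rel_le (P m) \<longrightarrow> d = c"
    using family_F0_finite_extremal(2)[OF F0, of ?S m] by blast
  then obtain z where z: "c = z m" "z \<in> K" "(x, z) \<in> LE" "(z, y) \<in> LE" by blast
  \<comment> \<open>Equal coordinates would be adjacent, but \<open>z\<close> lies in
    \<open>K\<close> and \<open>y\<close> in \<open>K'\<close>.\<close>
  have "z m \<noteq> y m"
    using m[rule_format, OF order_refl z(2) xy(2)] family_F0_R_refl[OF F0 limit_in[OF L(2)], of m] by auto
  then obtain d where d: "(z m, d) \<in> rel_le (P m)" "(d, y m) \<in> rel_le (P m)" "d \<noteq> z m"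
    "(z m, d) \<in> rel_R (P m)"
    using family_F0_successor[OF F0 limit_leD(3)[OF z(4), of m]] by blast
  obtain w where w: "(z, w) \<in> LE" "(w, y) \<in> LE" "w m = d"
    by (rule limit_intermediate[OF z(4) d(1,2)])
  have xw: "(x, w) \<in> LE" using limit_le_trans[OF z(3) w(1)] .
  have "w \<notin> K"
  proof
    assume "w \<in> K"
    then have "d \<in> ?S" using xw w(2,3) by blast
    then show False using c(2) d(1,3) z(1) by blast
  qed
  then have "w \<in> K'" using cover[OF xw w(2)] by blast
  then show False using m[rule_format, OF order_refl z(2), of w] d(4) w(3) by simp
qed

lemma closedin_comparable_class: "closedin T (E `` {u})"
proof (cases "u \<in> L")
  case True
  have "E `` {u} = (\<Inter>n. {v \<in> L. (u n, v n) \<in> rel_le (P n) \<or> (v n, u n) \<in> rel_le (P n)})"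
    using limit_comparable_iff[of u] True by auto
  then show ?thesis
    using clopen_cylinder(1)[of "\<lambda>a. (u n, a) \<in> rel_le (P n) \<or> (a, u n) \<in> rel_le (P n)" n for n]
    by (simp only:) (intro closedin_Inter, auto)
next
  case False
  then have "E `` {u} = {}" using limit_leD by blast
  then show ?thesis by simp
qed

text \<open>Two closed sets separating the image would pull back to closed sets covering the chain.
  A link between these has a single image point, which would lie in both sets.\<close>

lemma connectedin_comparable_class: "connectedin X (p ` (E `` {u}))"
  unfolding connectedin_closedin
proof (intro conjI notI)
  let ?B = "E `` {u}"
  have BL: "?B \<subseteq> L" using limit_leD by blast
  then show "p ` ?B \<subseteq> topspace X" unfolding quotient_topspace by blast
  assume "\<exists>E1 E2. closedin X E1 \<and> closedin X E2 \<and> p ` ?B \<subseteq> E1 \<union> E2 \<and> E1 \<inter> E2 \<inter> p ` ?B = {} \<and>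
    E1 \<inter> p ` ?B \<noteq> {} \<and> E2 \<inter> p ` ?B \<noteq> {}"
  then obtain E1 E2 where E: "closedin X E1" "closedin X E2" "p ` ?B \<subseteq> E1 \<union> E2"
    "E1 \<inter> E2 \<inter> p ` ?B = {}" "E1 \<inter> p ` ?B \<noteq> {}" "E2 \<inter> p ` ?B \<noteq> {}" by blast
  \<comment> \<open>Stated for arbitrary closed sets because the link lemma needs \<open>x\<close>
    below \<open>y\<close>: in the opposite case it is applied with the two sets exchanged.\<close>
  have no_link: "False" if F: "closedin X F" "closedin X F'" "p ` ?B \<subseteq> F \<union> F'" "F \<inter> F' \<inter> p ` ?B = {}"
    and xy: "x \<in> ?B" "y \<in> ?B" "p x \<in> F" "p y \<in> F'" "(x, y) \<in> LE" for F F' x y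
  proof -
    let ?K = "\<lambda>F. {w \<in> topspace T. p w \<in> F} \<inter> ?B"
    have cl: "closedin T (?K F)" if "closedin X F" for F
      using closedin_continuous_map_preimage[OF continuous_map_proj that] closedin_comparable_class
      by (rule closedin_Int)
    have "\<exists>a\<in>?K F. \<exists>b\<in>?K F'. (a, b) \<in> RR"
    proof (rule closed_cover_link[OF cl[OF F(1)] cl[OF F(2)] _ _ xy(5)])
      show "x \<in> ?K F" "y \<in> ?K F'" using xy BL limit_topspace by auto
      show "z \<in> ?K F \<union> ?K F'" if "(x, z) \<in> LE" "(z, y) \<in> LE" for z
      proof -
        have "(u, z) \<in> E" using comparable_trans[of u x z] xy(1) that(1) by blast
        then show ?thesis using F(3) BL limit_topspace by auto
      qed
    qed
    then obtain a b where ab: "a \<in> ?B" "b \<in> ?B" "p a \<in> F" "p b \<in> F'" "(a, b) \<in> RR" by blast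
    then have "p a = p b" using proj_eq_iff BL by blast
    then show False using ab F(4) by auto
  qed
  obtain x y where xy: "x \<in> ?B" "p x \<in> E1" "y \<in> ?B" "p y \<in> E2" using E(5,6) by blast
  have "(x, y) \<in> E" using comparable_trans[of x u y] xy(1,3) by blast
  then show False
  proof
    assume "(x, y) \<in> LE"
    then show False using no_link[OF E(1-4) xy(1,3,2,4)] by blast
  next
    assume "(x, y) \<in> LE\<inverse>"
    then have "(y, x) \<in> LE" by simp
    moreover have "p ` ?B \<subseteq> E2 \<union> E1" "E2 \<inter> E1 \<inter> p ` ?B = {}" using E(3,4) by blast+
    ultimately show False using no_link[OF E(2,1) _ _ xy(3,1,4,2)] by blast
  qed
qed

text \<open>For each \<open>n\<close>, comparability with \<open>u\<close> at level \<open>n\<close>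
  defines a clopen \<open>RR\<close>-saturated set, whose image is clopen in the quotient. A
  connected set through \<open>p u\<close> stays in all these images, and comparability at every
  level is comparability in the limit.\<close>

lemma connected_component_quotient:
  assumes u: "u \<in> L"
  shows "connected_component_of_set X (p u) = p ` (E `` {u})"
proof (rule connected_component_of_unique)
  show "p u \<in> p ` (E `` {u})" using limit_le_refl[OF u] by blast
  show "connectedin X (p ` (E `` {u}))" by (rule connectedin_comparable_class)
  fix S assume S: "p u \<in> S \<and> connectedin X S"
  show "S \<subseteq> p ` (E `` {u})"
  proof
    fix x assume x: "x \<in> S"
    have "x \<in> topspace X" using S x connectedin_subset_topspace by blast
    then obtain v where v: "v \<in> L" "x = p v" unfolding quotient_topspace by blast
    have "(u n, v n) \<in> rel_le (P n) \<or> (v n, u n) \<in> rel_le (P n)" for n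
    proof -
      let ?c = "\<lambda>a. (u n, a) \<in> rel_le (P n) \<or> (a, u n) \<in> rel_le (P n)"
      let ?W = "p ` {w \<in> L. ?c (w n)}"
      have sat: "?c (w' n)" if w: "w \<in> L" "w' \<in> L" "?c (w n)" "p w' = p w" for w w'
      proof -
        have "(w, w') \<in> RR" using proj_eq_iff[OF w(1,2)] w(4) by simp
        then have "(w n, w' n) \<in> rel_le (P n) \<or> (w' n, w n) \<in> rel_le (P n)"
          by (rule family_F0_R_comparable[OF F0 limit_RD(3)])
        then show ?thesis by (rule family_F0_comparable_trans[OF F0 w(3)])
      qed
      \<comment> \<open>By saturation the preimage is the cylinder itself, so the quotient map
        transfers its clopenness to \<open>?W\<close>.\<close>
      have pre: "{w \<in> topspace T. p w \<in> ?W} = {w \<in> L. ?c (w n)}"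
      proof (intro subset_antisym subsetI)
        fix w' assume w': "w' \<in> {w \<in> topspace T. p w \<in> ?W}"
        then obtain w where "w \<in> L" "?c (w n)" "p w' = p w" by auto
        then show "w' \<in> {w \<in> L. ?c (w n)}" using sat[of w w'] w' by (simp add: limit_topspace)
      qed (simp add: limit_topspace)
      have sub: "?W \<subseteq> topspace X" unfolding quotient_topspace by blast
      have "openin T {w \<in> topspace T. p w \<in> ?W}" "closedin T {w \<in> topspace T. p w \<in> ?W}"
        unfolding pre by (rule clopen_cylinder)+
      then have "openin X ?W" "closedin X ?W"
        using quotient_map_proj[unfolded quotient_map_def] quotient_map_proj[unfolded quotient_map_closedin] sub
        by simp_all
      then have "S \<subseteq> ?W \<or> disjnt S ?W" using S connectedin_clopen_cases by blast
      moreover have "p u \<in> ?W" using u family_F0_refl[OF F0 limit_in[OF u], of n] by blast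
      ultimately have "p v \<in> ?W" using S x v(2) unfolding disjnt_def by blast
      then have "v \<in> {w \<in> topspace T. p w \<in> ?W}" using v(1) limit_topspace by simp
      then show ?thesis unfolding pre by simp
    qed
    then have "(u, v) \<in> E" unfolding limit_comparable_iff using u v(1) by blast
    then show "x \<in> p ` (E `` {u})" using v(2) by blast
  qed
qed

lemma connected_components_quotient: "connected_components_of X = {p ` (E `` {u}) |u. u \<in> L}"
proof -
  have "connected_components_of X = (\<lambda>u. connected_component_of_set X (p u)) ` L"
    unfolding connected_components_of_def quotient_topspace by (rule image_image)
  also have "\<dots> = (\<lambda>u. p ` (E `` {u})) ` L"
    by (rule image_cong) (simp_all only: connected_component_quotient)
  finally show ?thesis by auto
qed

section \<open>Nondegenerate components are arcs\<close>

text \<open>On the image of one chain, different points have different and pointwise comparable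
  values under \<open>h\<close>, so the weighted sum separates them. The injective real function
  thus obtained exhibits the arc.\<close>

lemma arc_comparable_class:
  assumes v: "v \<in> E `` {u}" "w \<in> E `` {u}" "p v \<noteq> p w"
  shows "arc_in X (p ` (E `` {u}))"
proof -
  let ?C = "p ` (E `` {u})"
  obtain h :: "(nat \<Rightarrow> 'a) set \<Rightarrow> nat \<Rightarrow> real" where h: "continuous_map X euclidean h"
    "inj_on h (topspace X)" and h01: "\<forall>x k. h x k \<in> {0..1}"
    and mono: "\<forall>u v. (u, v) \<in> LE \<longrightarrow> h (p u) \<le> h (p v)" using quotient_embedding by blast
  define s where "s y = (\<Sum>k. (1/2)^k * y k)" for y :: "nat \<Rightarrow> real"
  have r01: "y k \<in> {0..1}" if "y \<in> range h" for y k using h01 that by blast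
  have s_cont: "continuous_on (range h) s"
    unfolding s_def by (rule continuous_on_geometric_weighted_sum) (rule r01)
  have s_mono: "s (h x) < s (h y)" if "h x \<le> h y" "h x \<noteq> h y" for x y
    unfolding s_def by (rule strict_mono_geometric_weighted_sum[of "range h"]) (rule r01, assumption, simp_all add: that)
  have BL: "E `` {u} \<subseteq> L" using limit_leD by blast
  show ?thesis
  proof (rule arc_in_if_injective_real_function)
    show "compactin X ?C"
      using closedin_compact_space[OF compact_limit closedin_comparable_class] continuous_map_proj
      by (rule image_compactin)
    show "connectedin X ?C" by (rule connectedin_comparable_class)
    show "p v \<in> ?C" "p w \<in> ?C" "p v \<noteq> p w" using v by blast+
    have "continuous_map X (top_of_set (range h)) h" using h(1) by (simp add: continuous_map_in_subtopology)
    then have "continuous_map X euclideanreal (s \<circ> h)"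
      by (rule continuous_map_compose) (simp add: s_cont)
    then show "continuous_map (subtopology X ?C) euclideanreal (s \<circ> h)"
      by (rule continuous_map_from_subtopology)
    show "inj_on (s \<circ> h) ?C"
    proof (rule inj_onI, rule ccontr)
      fix x y assume xy: "x \<in> ?C" "y \<in> ?C" and eq: "(s \<circ> h) x = (s \<circ> h) y" and ne: "x \<noteq> y"
      obtain a b where ab: "(u, a) \<in> E" "(u, b) \<in> E" "x = p a" "y = p b" using xy by blast
      have "x \<in> topspace X" "y \<in> topspace X" using ab BL unfolding quotient_topspace by blast+
      then have hne: "h x \<noteq> h y" using h(2) ne unfolding inj_on_def by blast
      have "(a, b) \<in> E" using comparable_trans[of a u b] ab(1,2) by blast
      then have "h x \<le> h y \<or> h y \<le> h x" using mono ab(3,4) by blast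
      then show False using s_mono[of x y] s_mono[of y x] hne eq by auto
    qed
  qed
qed

text \<open>If \<open>p\<close> is constant on the chain, any two of its points are
  \<open>RR\<close>-related. Three different points would have a middle one strictly inside such a
  pair, against convexity.\<close>

lemma comparable_class_collapsed:
  assumes const: "\<And>v w. v \<in> E `` {u} \<Longrightarrow> w \<in> E `` {u} \<Longrightarrow> p v = p w"
  shows "finite (E `` {u}) \<and> card (E `` {u}) \<le> 2"
proof (rule ccontr)
  assume neg: "\<not> ?thesis"
  have BL: "E `` {u} \<subseteq> L" using limit_leD by blast
  have "\<exists>S\<subseteq>E `` {u}. finite S \<and> card S = 3"
  proof (cases "finite (E `` {u})")
    case True
    then have "3 \<le> card (E `` {u})" using neg by simp
    then obtain S where "S \<subseteq> E `` {u}" "card S = 3" "finite S" by (rule obtain_subset_with_card_n)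
    then show ?thesis by blast
  next
    case False
    from infinite_arbitrarily_large[OF this, of 3] show ?thesis by blast
  qed
  then obtain S where S: "S \<subseteq> E `` {u}" "card S = 3" by blast
  then obtain a b c where "S = {a, b, c}" and ne: "a \<noteq> b" "b \<noteq> c" "a \<noteq> c"
    unfolding card_3_iff by blast
  then have abc: "a \<in> E `` {u}" "b \<in> E `` {u}" "c \<in> E `` {u}" using S(1) by blast+
  have R: "(x, y) \<in> RR" if "x \<in> E `` {u}" "y \<in> E `` {u}" for x y
    using const[OF that] proj_eq_iff that BL by blast
  have bet: "y = x \<or> y = z"
    if "x \<in> E `` {u}" "z \<in> E `` {u}" "(x, y) \<in> LE" "(y, z) \<in> LE" for x y z
    using limit_R_between[OF R[OF that(1,2)] that(3,4)] .
  have cmp: "(x, y) \<in> LE \<or> (y, x) \<in> LE" if "x \<in> E `` {u}" "y \<in> E `` {u}" for x y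
    using comparable_trans[of x u y] that by blast
  show False
    using cmp[OF abc(1,2)] cmp[OF abc(2,3)] cmp[OF abc(1,3)]
      bet[OF abc(1,3), of b] bet[OF abc(3,1), of b] bet[OF abc(1,2), of c] bet[OF abc(2,1), of c]
      bet[OF abc(2,3), of a] bet[OF abc(3,2), of a] ne
    by blast
qed

lemma smooth_fence_quotient: "smooth_fence X"
  unfolding smooth_fence_def fence_def
proof (intro conjI ballI exI[of _ "quotient_le P \<phi>"])
  show "compact_space X" by (rule compact_quotient)
  show "metrizable_space X" by (rule metrizable_quotient)
  show "partial_order_on (topspace X) (quotient_le P \<phi>)" by (rule partial_order_quotient_le)
  show "closedin (prod_topology X X) (quotient_le P \<phi>)" by (rule closedin_quotient_le)
  fix C assume "C \<in> connected_components_of X"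
  then obtain u where u: "u \<in> L" "C = p ` (E `` {u})" unfolding connected_components_quotient by blast
  show "(\<exists>x. C = {x}) \<or> arc_in X C"
  proof (cases "\<exists>v\<in>E `` {u}. \<exists>w\<in>E `` {u}. p v \<noteq> p w")
    case True
    then obtain v w where "v \<in> E `` {u}" "w \<in> E `` {u}" "p v \<noteq> p w" by blast
    then have "arc_in X C" unfolding u(2) by (rule arc_comparable_class)
    then show ?thesis ..
  next
    case False
    have self: "u \<in> E `` {u}" using limit_le_refl[OF u(1)] by blast
    have "p v = p u" if "v \<in> E `` {u}" for v using False self that by blast
    then have "p ` (E `` {u}) \<subseteq> {p u}" by blast
    moreover have "p u \<in> p ` (E `` {u})" using self by (rule imageI)
    ultimately have "C = {p u}" unfolding u(2) by blast
    then show ?thesis by blast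
  qed
  show "total_on C (quotient_le P \<phi>)"
  proof (rule total_onI)
    fix x y assume "x \<in> C" "y \<in> C"
    then obtain v w where vw: "(u, v) \<in> E" "(u, w) \<in> E" "x = p v" "y = p w" unfolding u(2) by blast
    then have "v \<in> L" "w \<in> L" using limit_leD by blast+
    moreover have "(v, w) \<in> E" using comparable_trans[of v u w] vw(1,2) by blast
    ultimately show "(x, y) \<in> quotient_le P \<phi> \<or> (y, x) \<in> quotient_le P \<phi>"
      using quotient_comparable_iff[of v w] vw(3,4) by simp
  qed
qed

lemma arc_maximal_chain:
  assumes B: "B \<in> maximal_chains LE" "infinite B \<or> card B > 2"
  shows "arc_in X (p ` B)"
proof -
  obtain u where u: "B = E `` {u}" using B(1) unfolding maximal_chains_limit by blast
  show ?thesis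
  proof (rule ccontr)
    assume no: "\<not> ?thesis"
    have "p v = p w" if "v \<in> E `` {u}" "w \<in> E `` {u}" for v w
      using arc_comparable_class[OF that] no u by auto
    then have "finite (E `` {u}) \<and> card (E `` {u}) \<le> 2" by (rule comparable_class_collapsed)
    then show False using B(2) u by simp
  qed
qed

end

theorem theorem4p4:
  fixes P :: "nat \<Rightarrow> 'a lr_struct" and \<phi> :: "nat \<Rightarrow> nat \<Rightarrow> 'a \<Rightarrow> 'a"
  assumes "fine_sequence P \<phi>"
    and "\<And>n. P n \<in> family_F0"
  shows "smooth_fence (limit_quotient P \<phi>) \<and>
    connected_components_of (limit_quotient P \<phi>) = maximal_chains (quotient_le P \<phi>) \<and>
    connected_components_of (limit_quotient P \<phi>) =
      {limit_proj P \<phi> ` B |B. B \<in> maximal_chains (limit_le P \<phi>)} \<and>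
    (\<forall>B\<in>maximal_chains (limit_le P \<phi>). infinite B \<or> card B > 2 \<longrightarrow>
       arc_in (limit_quotient P \<phi>) (limit_proj P \<phi> ` B))"
proof -
  interpret fine_F0_sequence P \<phi>
    using assms by (rule fine_F0_sequence.intro)
  show ?thesis
  proof (intro conjI ballI impI)
    show "connected_components_of X = maximal_chains (quotient_le P \<phi>)"
      unfolding connected_components_quotient maximal_chains_quotient ..
    show "connected_components_of X = {p ` B |B. B \<in> maximal_chains LE}"
      unfolding connected_components_quotient maximal_chains_limit by blast
  qed (rule smooth_fence_quotient, rule arc_maximal_chain)
qed

end
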